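(* Let $\mathbf{K}\subset\mathbb{R}^n$ be compact with nonempty interior, let $\mu$ be a finite Borel measure whose support is exactly $\mathbf{K}$, with moments $\mathbf{z}=(z_\alpha)_{\alpha\in\mathbb{N}^n}$, $z_\alpha=\int_{\mathbf{K}}\mathbf{x}^\alpha\,d\mu$. Let $$\mathcal{P}:\quad\rho=\inf_{g\in\mathbf{P}[\mathbf{x}]_{2d}}\left\{\int_{\mathbb{R}^n}\exp(-g)\,d\mathbf{x}\;:\; 1-g\in C_{2d}(\mathbf{K})\right\},$$ and for $k\in\mathbb{N}$ consider the finite-dimensional convex optimization problem $$\mathcal{P}_k:\quad\rho_k=\inf_{g\in\mathbf{P}[\mathbf{x}]_{2d}}\left\{\int_{\mathbb{R}^n}\exp(-g)\,d\mathbf{x}\;:\;\mathbf{M}_k(1-g,\mathbf{z})\succeq0\right\}.$$ The sequence $(\rho_k)$, $k\in\mathbb{N}$, is monotone nondecreasing with $\rho_k\le\rho$, and: (a) If $\mathcal{P}_k$ has an optimal solution $g_k^*\in\mathbf{P}[\mathbf{x}]_{2d}$ then there exists a sum of squares polynomial $\sigma_k^*\in\Sigma[\mathbf{x}]_k$ such that $$(1)\quad\int_{\mathbb{R}^n}\mathbf{x}^\alpha\exp(-g_k^* )\,d\mathbf{x}=\int_{\mathbf{K}}\mathbf{x}^\alpha\sigma_k^*\,d\mu\quad\forall\,|\alpha|=2d,\qquad(2)\quad\int_{\mathbf{K}}(1-g_k^* )\,\sigma_k^*\,d\mu=0,$$ and $\rho_k=\frac{2d}{n}\int_{\mathbf{K}}\sigma_k^*\,d\mu$.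 (b) Conversely, if (1)-(2) hold for some $g_k^*\in\mathbf{P}[\mathbf{x}]_{2d}$ and some $\sigma_k^*\in\Sigma[\mathbf{x}]_k$, then $g_k^*$ is an optimal solution of $\mathcal{P}_k$. (c) If in addition the optimal solutions $g_k^*=\sum_{|\alpha|=2d}g^*_{k\alpha}\mathbf{x}^\alpha$ of $\mathcal{P}_k$ satisfy $$\sup_k\,\sup_{|\alpha|=2d}|g^*_{k\alpha}|<M$$ for some $M>0$, then $\rho_k\to\rho$ and $\mathcal{P}$ has an optimal solution $g^*$.
   Context: $d\ge1$ is an integer. $\mathbf{P}[\mathbf{x}]_{2d}$ is the convex cone of homogeneous polynomials $g\in\mathbb{R}[x_1,\dots,x_n]$ of degree $2d$ with compact sublevel set $\{\mathbf{x}:g(\mathbf{x})\le 1\}$. $C_{2d}(\mathbf{K})$ is the convex cone of real polynomials in $n$ variables of degree at most $2d$ that are nonnegative on $\mathbf{K}$. For a polynomial $p=\sum_\gamma p_\gamma\mathbf{x}^\gamma$, the localizing matrix $\mathbf{M}_k(p,\mathbf{z})$ is the real symmetric matrix with rows and columns indexed by $\alpha,\beta\in\mathbb{N}^n$ with $|\alpha|,|\beta|\le k$, and entries $\mathbf{M}_k(p,\mathbf{z})(\alpha,\beta)=\int_{\mathbf{K}}p(\mathbf{x})\mathbf{x}^{\alpha+\beta}\,d\mu=\sum_\gamma p_\gamma z_{\alpha+\beta+\gamma}$; $\succeq0$ means positive semidefinite. $\Sigma[\mathbf{x}]_k$ is the set of sums of squares of real polynomials of degree at most $k$. For $\alpha\in\mathbb{N}^n$,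 $|\alpha|=\sum_i\alpha_i$.
   Formalization: (b) also requires g_k* to be feasible for P_k; in (c), g* is an optimal solution of P only if the sublevel sets of the g_k* are uniformly bounded; otherwise ρ is attained by a form with 1-g in C_2d(K) and integrable exp(-g), whose sublevel set may be non-compact. *)

theory Defs
  imports "HOL-Analysis.Analysis" "HOL-Library.Poly_Mapping"
begin

text \<open>
  Multi-indices are vectors of naturals. Finitely supported maps from the additive monoid
  \<^typ>\<open>nat ^ 'n\<close> to the reals, with the convolution product of
  \<^theory>\<open>HOL-Library.Poly_Mapping\<close>, form the polynomial ring in \<^term>\<open>CARD('n)\<close> variables;
  \<^term>\<open>Poly_Mapping.lookup p \<alpha>\<close> is the coefficient of the monomial with exponent \<^term>\<open>\<alpha>\<close>.
\<close>

type_synonym 'n midx = "nat ^ 'n"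
type_synonym 'n rpoly = "(nat ^ 'n) \<Rightarrow>\<^sub>0 real"

definition mdeg :: "'n::finite midx \<Rightarrow> nat" where
  "mdeg \<alpha> = (\<Sum>i\<in>UNIV. \<alpha> $ i)"

definition monomial :: "'n::finite midx \<Rightarrow> real ^ 'n \<Rightarrow> real" where
  "monomial \<alpha> x = (\<Prod>i\<in>UNIV. (x $ i) ^ (\<alpha> $ i))"

definition peval :: "'n::finite rpoly \<Rightarrow> real ^ 'n \<Rightarrow> real" where
  "peval p x = (\<Sum>\<alpha>\<in>Poly_Mapping.keys p. Poly_Mapping.lookup p \<alpha> * monomial \<alpha> x)"

definition polys_upto :: "nat \<Rightarrow> 'n::finite rpoly set" where
  "polys_upto m = {p. \<forall>\<alpha>\<in>Poly_Mapping.keys p. mdeg \<alpha> \<le> m}"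

definition forms :: "nat \<Rightarrow> 'n::finite rpoly set" where
  "forms m = {p. \<forall>\<alpha>\<in>Poly_Mapping.keys p. mdeg \<alpha> = m}"

definition sublevel :: "'n::finite rpoly \<Rightarrow> (real ^ 'n) set" where
  "sublevel g = {x. peval g x \<le> 1}"

text \<open>The cone $P[x]_m$. It does not contain the zero polynomial, whose sublevel set is not compact.\<close>

definition compact_forms :: "nat \<Rightarrow> 'n::finite rpoly set" where
  "compact_forms m = {g \<in> forms m. compact (sublevel g)}"

text \<open>The cone $C_m(K)$.\<close>

definition nonneg_polys :: "nat \<Rightarrow> (real ^ 'n::finite) set \<Rightarrow> 'n rpoly set" where
  "nonneg_polys m K = {p \<in> polys_upto m. \<forall>x\<in>K. 0 \<le> peval p x}"

text \<open>
  $\Sigma[x]_k$: the degree bound \<open>k\<close> is on the polynomials being squared, so the sums have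
  degree at most \<open>2 * k\<close>; this is the cone dual to the condition $M_k \succeq 0$.
\<close>

definition sos :: "nat \<Rightarrow> 'n::finite rpoly set" where
  "sos k = {\<sigma>. \<exists>qs. set qs \<subseteq> polys_upto k \<and> \<sigma> = (\<Sum>q\<leftarrow>qs. q ^ 2)}"

definition msupport :: "'a::topological_space measure \<Rightarrow> 'a set" where
  "msupport \<mu> = {x. \<forall>U. open U \<longrightarrow> x \<in> U \<longrightarrow> emeasure \<mu> U > 0}"

definition moments :: "(real ^ 'n::finite) set \<Rightarrow> (real ^ 'n) measure \<Rightarrow> 'n midx \<Rightarrow> real" where
  "moments K \<mu> \<alpha> = (LINT x:K|\<mu>. monomial \<alpha> x)"

text \<open>
  Entries of the localizing matrix. The size \<open>k\<close> of $M_k(p,z)$ enters only through the index set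
  \<open>{\<alpha>. mdeg \<alpha> \<le> k}\<close>, on which positive semidefiniteness is tested below.
\<close>

definition localizing_matrix ::
    "'n::finite rpoly \<Rightarrow> ('n midx \<Rightarrow> real) \<Rightarrow> 'n midx \<Rightarrow> 'n midx \<Rightarrow> real" where
  "localizing_matrix p z \<alpha> \<beta> = (\<Sum>\<gamma>\<in>Poly_Mapping.keys p. Poly_Mapping.lookup p \<gamma> * z (\<alpha> + \<beta> + \<gamma>))"

definition psd_on :: "'i set \<Rightarrow> ('i \<Rightarrow> 'i \<Rightarrow> real) \<Rightarrow> bool" where
  "psd_on I A \<longleftrightarrow> (\<forall>i\<in>I. \<forall>j\<in>I. A i j = A j i) \<and>
     (\<forall>v. 0 \<le> (\<Sum>i\<in>I. \<Sum>j\<in>I. v i * A i j * v j))"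

definition objective :: "'n::finite rpoly \<Rightarrow> real" where
  "objective g = (LINT x|lborel. exp (- peval g x))"

definition feasible :: "nat \<Rightarrow> (real ^ 'n::finite) set \<Rightarrow> 'n rpoly set" where
  "feasible d K = {g \<in> compact_forms (2 * d). 1 - g \<in> nonneg_polys (2 * d) K}"

definition feasible_relax ::
    "nat \<Rightarrow> (real ^ 'n::finite) set \<Rightarrow> (real ^ 'n) measure \<Rightarrow> nat \<Rightarrow> 'n rpoly set" where
  "feasible_relax d K \<mu> k = {g \<in> compact_forms (2 * d).
     psd_on {\<alpha>. mdeg \<alpha> \<le> k} (localizing_matrix (1 - g) (moments K \<mu>))}"

text \<open>Infima are taken in the extended reals, so that no convention about empty sets is involved.\<close>

definition opt_val :: "nat \<Rightarrow> (real ^ 'n::finite) set \<Rightarrow> ereal" where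
  "opt_val d K = (INF g\<in>feasible d K. ereal (objective g))"

definition opt_val_relax ::
    "nat \<Rightarrow> (real ^ 'n::finite) set \<Rightarrow> (real ^ 'n) measure \<Rightarrow> nat \<Rightarrow> ereal" where
  "opt_val_relax d K \<mu> k = (INF g\<in>feasible_relax d K \<mu> k. ereal (objective g))"

definition is_optimal :: "nat \<Rightarrow> (real ^ 'n::finite) set \<Rightarrow> 'n rpoly \<Rightarrow> bool" where
  "is_optimal d K = is_arg_min objective (\<lambda>g. g \<in> feasible d K)"

definition is_optimal_relax ::
    "nat \<Rightarrow> (real ^ 'n::finite) set \<Rightarrow> (real ^ 'n) measure \<Rightarrow> nat \<Rightarrow> 'n rpoly \<Rightarrow> bool" where
  "is_optimal_relax d K \<mu> k = is_arg_min objective (\<lambda>g. g \<in> feasible_relax d K \<mu> k)"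

definition moment_condition ::
    "nat \<Rightarrow> (real ^ 'n::finite) set \<Rightarrow> (real ^ 'n) measure \<Rightarrow> 'n rpoly \<Rightarrow> 'n rpoly \<Rightarrow> bool" where
  "moment_condition d K \<mu> g \<sigma> \<longleftrightarrow> (\<forall>\<alpha>. mdeg \<alpha> = 2 * d \<longrightarrow>
     (LINT x|lborel. monomial \<alpha> x * exp (- peval g x)) =
     (LINT x:K|\<mu>. monomial \<alpha> x * peval \<sigma> x))"

definition complementarity ::
    "(real ^ 'n::finite) set \<Rightarrow> (real ^ 'n) measure \<Rightarrow> 'n rpoly \<Rightarrow> 'n rpoly \<Rightarrow> bool" where
  "complementarity K \<mu> g \<sigma> \<longleftrightarrow> (LINT x:K|\<mu>. (1 - peval g x) * peval \<sigma> x) = 0"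

end

theory Submission
  imports Defs "HOL-Computational_Algebra.Polynomial"
begin

text \<open>
  The objective is convex, with gradient inequality
  \<open>objective f - objective g \<ge> \<integral> (g - f) exp (- g)\<close>. Under (1) and (2) the right-hand side is
  \<open>\<integral> (g - f) \<sigma> d\<mu> = \<integral> (1 - f) \<sigma> d\<mu> \<ge> 0\<close>, which gives (b). For (a), a sum of squares with (1) and
  (2) is a preimage of a given vector under finitely many linear functionals. They map the cone of
  sums of squares onto a closed cone, so if there is no preimage, a separating hyperplane yields a
  feasible descent direction at \<open>g\<close>. The value of \<open>\<rho>\<^sub>k\<close> follows from
  \<open>\<integral> g exp (- g) = n / (2 d) * \<integral> exp (- g)\<close>, a consequence of homogeneity. For (c), a
  subsequence of the \<open>g\<^sub>k\<close> converges coefficientwise. By Fatou's lemma the objective of the limit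
  is at most the limit of the \<open>\<rho>\<^sub>k\<close>, and \<open>1 - g\<close> is nonnegative on \<open>K\<close> because all its
  localizing matrices are positive semidefinite. The limit need not have a compact sublevel set;
  convex combinations with a feasible form show that its objective is still at least \<open>\<rho>\<close>.
\<close>

section \<open>Polynomials and coercive forms\<close>

text \<open>A linear image of a closed cone is closed only with some compactness. Here it comes from
  the choice of functionals: \<open>1 - g\<close> and the monomials of degree \<open>2 * d\<close>,
  the latter weighted with the coefficients of \<open>g\<close>, add up to 1, so the values
  prescribed in (1) and (2) fix the total mass of \<sigma>. The mass bounds a Gram matrix of
  \<sigma> because the integral of \<open>q ^ 2\<close> is positive definite on polynomials of
  degree at most \<open>k\<close>; this is where the interior of \<open>K\<close> enters. The
  objective is never differentiated under the integral sign: descent is read off the gradient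
  inequality taken at the new point. The obstacle in (c) is that coefficientwise limits can leave
  the cone while \<open>exp (- g)\<close> stays integrable: x^6 / j + x^4 y^2 + y^6 lies in the cone
  for every j > 0, but its limit vanishes on the x-axis. Hence (c) speaks of a form that attains
  \<rho> and satisfies the inequality on \<open>K\<close>; it is an optimal solution as soon as the
  sublevel sets of the \<open>g k\<close> are uniformly bounded.\<close>

lemma monomial_0 [simp]: "monomial 0 x = 1"
  by (simp add: monomial_def)

lemma monomial_add: "monomial (\<alpha> + \<beta>) x = monomial \<alpha> x * monomial \<beta> x"
  by (simp add: monomial_def power_add prod.distrib)

lemma monomial_axis: "monomial (axis i 1) x = x $ i"
proof -
  have "monomial (axis i 1) x = (\<Prod>j\<in>UNIV. if j = i then x $ j else 1)"
    unfolding monomial_def by (rule prod.cong) (auto simp: axis_def)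
  then show ?thesis by simp
qed

lemma monomial_scaleR: "monomial \<alpha> (t *\<^sub>R x) = t ^ mdeg \<alpha> * monomial \<alpha> x"
  by (simp add: monomial_def mdeg_def power_mult_distrib prod.distrib power_sum)

lemma continuous_on_monomial [continuous_intros]: "continuous_on S (monomial \<alpha>)"
  unfolding monomial_def[abs_def] by (intro continuous_intros)

lemma abs_monomial_le: "\<bar>monomial \<alpha> x\<bar> \<le> norm x ^ mdeg \<alpha>"
proof -
  have "\<bar>monomial \<alpha> x\<bar> = (\<Prod>i\<in>UNIV. \<bar>x $ i\<bar> ^ (\<alpha> $ i))"
    by (simp add: monomial_def abs_prod power_abs)
  also have "\<dots> \<le> (\<Prod>i\<in>UNIV. norm x ^ (\<alpha> $ i))"
    by (intro prod_mono conjI power_mono component_le_norm_cart) auto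
  finally show ?thesis by (simp add: mdeg_def power_sum)
qed

lemma mdeg_0 [simp]: "mdeg 0 = 0"
  by (simp add: mdeg_def)

lemma finite_mdeg_le: "finite {\<alpha> :: 'n::finite midx. mdeg \<alpha> \<le> k}"
proof (rule finite_subset)
  show "finite (vec_lambda ` (PiE (UNIV :: 'n set) (\<lambda>_. {..k})))"
    by (intro finite_imageI finite_PiE) auto
  show "{\<alpha> :: 'n midx. mdeg \<alpha> \<le> k} \<subseteq> vec_lambda ` (PiE (UNIV :: 'n set) (\<lambda>_. {..k}))"
  proof
    fix \<alpha> :: "'n midx" assume "\<alpha> \<in> {\<alpha>. mdeg \<alpha> \<le> k}"
    then have "\<alpha> $ i \<le> k" for i
      unfolding mdeg_def using member_le_sum[of i UNIV "\<lambda>i. \<alpha> $ i"] by force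
    then show "\<alpha> \<in> vec_lambda ` (PiE (UNIV :: 'n set) (\<lambda>_. {..k}))"
      by (intro image_eqI[of _ _ "vec_nth \<alpha>"]) auto
  qed
qed

lemma finite_mdeg_eq: "finite {\<alpha> :: 'n::finite midx. mdeg \<alpha> = k}"
  by (rule finite_subset[OF _ finite_mdeg_le[of k]]) auto

section \<open>Evaluation as a ring homomorphism\<close>

lemma peval_superset:
  assumes "finite A" "Poly_Mapping.keys p \<subseteq> A"
  shows "peval p x = (\<Sum>\<alpha>\<in>A. Poly_Mapping.lookup p \<alpha> * monomial \<alpha> x)"
  unfolding peval_def
  by (rule sum.mono_neutral_left) (use assms in \<open>auto simp: in_keys_iff\<close>)

lemma peval_add: "peval (p + q) x = peval p x + peval q x"
proof -
  let ?A = "Poly_Mapping.keys p \<union> Poly_Mapping.keys q"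
  have "peval (p + q) x = (\<Sum>\<alpha>\<in>?A. Poly_Mapping.lookup (p + q) \<alpha> * monomial \<alpha> x)"
    by (rule peval_superset) (auto simp: keys_add)
  then show ?thesis
    by (simp add: peval_superset[of ?A p] peval_superset[of ?A q] lookup_add
        distrib_right sum.distrib)
qed

lemma peval_0 [simp]: "peval 0 x = 0"
  by (simp add: peval_def)

lemma peval_uminus: "peval (- p) x = - peval p x"
  using peval_add[of p "- p" x] by simp

lemma peval_diff: "peval (p - q) x = peval p x - peval q x"
  using peval_add[of p "- q" x] by (simp add: peval_uminus)

lemma peval_sum: "peval (\<Sum>i\<in>A. f i) x = (\<Sum>i\<in>A. peval (f i) x)"
  by (induction A rule: infinite_finite_induct) (auto simp: peval_add)

lemma peval_sum_list: "peval (sum_list ps) x = (\<Sum>p\<leftarrow>ps. peval p x)"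
  by (induction ps) (auto simp: peval_add)

lemma peval_single: "peval (Poly_Mapping.single \<alpha> c) x = c * monomial \<alpha> x"
  by (simp add: peval_def lookup_single)

lemma peval_1 [simp]: "peval 1 x = 1"
  using peval_single[of 0 1 x] by simp

lemma poly_mapping_sum_single: "p = (\<Sum>\<alpha>\<in>Poly_Mapping.keys p. Poly_Mapping.single \<alpha> (Poly_Mapping.lookup p \<alpha>))"
  by (rule poly_mapping_eqI)
     (auto simp: lookup_sum lookup_single when_def in_keys_iff)

lemma peval_mult: "peval (p * q) x = peval p x * peval q x"
proof -
  have "p * q = (\<Sum>\<alpha>\<in>Poly_Mapping.keys p. \<Sum>\<beta>\<in>Poly_Mapping.keys q.
      Poly_Mapping.single (\<alpha> + \<beta>) (Poly_Mapping.lookup p \<alpha> * Poly_Mapping.lookup q \<beta>))"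
    by (subst (1) poly_mapping_sum_single[of p], subst (1) poly_mapping_sum_single[of q])
       (simp add: sum_product mult_single)
  then have "peval (p * q) x = (\<Sum>\<alpha>\<in>Poly_Mapping.keys p. \<Sum>\<beta>\<in>Poly_Mapping.keys q.
      (Poly_Mapping.lookup p \<alpha> * Poly_Mapping.lookup q \<beta>) * monomial (\<alpha> + \<beta>) x)"
    by (simp only: peval_sum peval_single)
  also have "\<dots> = peval p x * peval q x"
    by (simp add: monomial_add peval_def sum_product mult_ac)
  finally show ?thesis .
qed

lemma peval_power: "peval (p ^ k) x = peval p x ^ k"
  by (induction k) (auto simp: peval_mult)

lemma continuous_on_peval [continuous_intros]: "continuous_on S (peval p)"
  unfolding peval_def[abs_def] by (intro continuous_intros)

lemma borel_measurable_peval [measurable]: "peval p \<in> borel_measurable borel"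
  by (intro borel_measurable_continuous_onI continuous_intros)

section \<open>Polynomials and forms with prescribed coefficients\<close>

definition poly_of :: "'n::finite midx set \<Rightarrow> ('n midx \<Rightarrow> real) \<Rightarrow> 'n rpoly" where
  "poly_of A c = (\<Sum>\<alpha>\<in>A. Poly_Mapping.single \<alpha> (c \<alpha>))"

lemma peval_poly_of: "peval (poly_of A c) x = (\<Sum>\<alpha>\<in>A. c \<alpha> * monomial \<alpha> x)"
  by (simp add: poly_of_def peval_sum peval_single)

lemma lookup_poly_of:
  "finite A \<Longrightarrow> Poly_Mapping.lookup (poly_of A c) \<alpha> = (if \<alpha> \<in> A then c \<alpha> else 0)"
  by (auto simp: poly_of_def lookup_sum lookup_single when_def)

lemma keys_poly_of: "finite A \<Longrightarrow> Poly_Mapping.keys (poly_of A c) \<subseteq> A"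
  by (auto simp: in_keys_iff lookup_poly_of split: if_splits)

abbreviation form_of :: "nat \<Rightarrow> ('n::finite midx \<Rightarrow> real) \<Rightarrow> 'n rpoly" where
  "form_of m \<equiv> poly_of {\<alpha>. mdeg \<alpha> = m}"

lemma form_of_in_forms: "form_of m c \<in> forms m"
  using keys_poly_of[OF finite_mdeg_eq, of m c] by (auto simp: forms_def)

lemma peval_form:
  "g \<in> forms m \<Longrightarrow> peval g x = (\<Sum>\<alpha> | mdeg \<alpha> = m. Poly_Mapping.lookup g \<alpha> * monomial \<alpha> x)"
  by (rule peval_superset[OF finite_mdeg_eq]) (auto simp: forms_def)

lemma peval_poly_upto:
  "p \<in> polys_upto m \<Longrightarrow> peval p x = (\<Sum>\<alpha> | mdeg \<alpha> \<le> m. Poly_Mapping.lookup p \<alpha> * monomial \<alpha> x)"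
  by (rule peval_superset[OF finite_mdeg_le]) (auto simp: polys_upto_def)

lemma poly_of_in_polys_upto: "poly_of {\<alpha>. mdeg \<alpha> \<le> m} c \<in> polys_upto m"
  using keys_poly_of[OF finite_mdeg_le, of m c] by (auto simp: polys_upto_def)

lemma peval_form_scaleR: "g \<in> forms m \<Longrightarrow> peval g (t *\<^sub>R x) = t ^ m * peval g x"
  by (simp add: peval_form monomial_scaleR sum_distrib_left mult_ac)

lemma peval_form_combination:
  assumes "g \<in> forms m" "h \<in> forms m"
  shows "peval (form_of m (\<lambda>\<alpha>. a * Poly_Mapping.lookup g \<alpha> + b * Poly_Mapping.lookup h \<alpha>)) x
      = a * peval g x + b * peval h x"
  by (simp add: peval_poly_of peval_form[OF assms(1)] peval_form[OF assms(2)]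
      sum_distrib_left sum.distrib[symmetric] algebra_simps)

lemma one_minus_form_in_polys_upto: "g \<in> forms m \<Longrightarrow> 1 - g \<in> polys_upto m"
  by (auto simp: forms_def polys_upto_def in_keys_iff lookup_minus lookup_one when_def
      split: if_splits)

text \<open>Transfers the Stone-Weierstrass theorem, which speaks of the inductively defined
  \<open>real_polynomial_function\<close>, to finitely supported coefficient maps.\<close>

lemma peval_real_polynomial_function:
  assumes "real_polynomial_function f"
  shows "\<exists>p. \<forall>x. peval p x = f (x :: real ^ 'n::finite)"
  using assms
proof induction
  case (linear f)
  let ?p = "\<Sum>i\<in>UNIV. Poly_Mapping.single (axis i 1) (f (axis i 1)) :: 'n rpoly"
  have "peval ?p x = f x" for x
  proof -
    interpret bounded_linear f by fact
    have "f x = f (\<Sum>i\<in>UNIV. (x $ i) *\<^sub>R axis i 1)"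
      by (subst basis_expansion[symmetric]) (simp add: scalar_mult_eq_scaleR)
    then show ?thesis
      by (simp add: sum scaleR peval_sum peval_single monomial_axis mult.commute
          del: One_nat_def)
  qed
  then show ?case by blast
next
  case (const c)
  have "peval (Poly_Mapping.single 0 c) x = c" for x :: "real ^ 'n"
    by (simp add: peval_single)
  then show ?case by blast
next
  case (add f g)
  then show ?case by (metis peval_add)
next
  case (mult f g)
  then show ?case by (metis peval_mult)
qed

text \<open>Doubling the \<open>i\<close>-th coordinate multiplies \<open>x\<^sup>\<alpha>\<close> by \<open>2 ^ \<alpha>\<^sub>i\<close>; subtracting the
  multiple of the identity belonging to \<open>\<beta>\<close> removes all monomials with the same
  \<open>i\<close>-th exponent as \<open>\<beta>\<close>.\<close>

lemma monomials_independent: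
  assumes "finite A" "\<And>x. (\<Sum>\<alpha>\<in>A. c \<alpha> * monomial \<alpha> x) = 0" "\<alpha> \<in> A"
  shows "c \<alpha> = 0"
  using assms
proof (induction "card A" arbitrary: A c \<alpha> rule: less_induct)
  case less
  show ?case
  proof (cases "A = {\<alpha>}")
    case True
    then show ?thesis using less.prems(2)[of "\<chi> i. 1"] by (simp add: monomial_def)
  next
    case False
    then obtain \<beta> where \<beta>: "\<beta> \<in> A" "\<beta> \<noteq> \<alpha>" using less.prems(3) by auto
    then obtain i where i: "\<alpha> $ i \<noteq> \<beta> $ i" by (metis vec_eq_iff)
    define A' where "A' = {\<gamma> \<in> A. \<gamma> $ i \<noteq> \<beta> $ i}"
    have A': "A' \<subseteq> A" "\<beta> \<in> A - A'" "\<alpha> \<in> A'" using \<beta> i less.prems(3) by (auto simp: A'_def)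
    have cardA': "card A' < card A" using A' less.prems(1) by (intro psubset_card_mono) auto
    have double: "monomial \<gamma> (\<chi> j. if j = i then 2 * x $ j else x $ j)
        = 2 ^ (\<gamma> $ i) * monomial \<gamma> x" for \<gamma> and x :: "real ^ 'a"
    proof -
      have "monomial \<gamma> (\<chi> j. if j = i then 2 * x $ j else x $ j)
          = (\<Prod>j\<in>UNIV. (if j = i then 2 ^ (\<gamma> $ i) else 1) * x $ j ^ (\<gamma> $ j))"
        unfolding monomial_def by (rule prod.cong) (auto simp: power_mult_distrib)
      then show ?thesis by (simp add: prod.distrib monomial_def)
    qed
    have "(\<Sum>\<gamma>\<in>A'. (c \<gamma> * (2 ^ (\<gamma> $ i) - 2 ^ (\<beta> $ i))) * monomial \<gamma> x) = 0" for x
    proof -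
      have "(\<Sum>\<gamma>\<in>A'. (c \<gamma> * (2 ^ (\<gamma> $ i) - 2 ^ (\<beta> $ i))) * monomial \<gamma> x)
          = (\<Sum>\<gamma>\<in>A. (c \<gamma> * (2 ^ (\<gamma> $ i) - 2 ^ (\<beta> $ i))) * monomial \<gamma> x)"
        using less.prems(1) by (intro sum.mono_neutral_left) (auto simp: A'_def)
      also have "\<dots> = (\<Sum>\<gamma>\<in>A. c \<gamma> * monomial \<gamma> (\<chi> j. if j = i then 2 * x $ j else x $ j))
          - 2 ^ (\<beta> $ i) * (\<Sum>\<gamma>\<in>A. c \<gamma> * monomial \<gamma> x)"
        by (simp add: double sum_distrib_left sum_subtractf algebra_simps)
      finally show ?thesis using less.prems(2) by simp
    qed
    from less.hyps[OF cardA' _ this A'(3)] less.prems(1) A'(1) i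
    show ?thesis by (auto intro: finite_subset)
  qed
qed

lemma peval_along_line:
  fixes a w :: "real ^ 'n::finite"
  shows "\<exists>r :: real poly. \<forall>t. poly r t = peval p (a + t *\<^sub>R w)"
proof
  let ?r = "\<Sum>\<alpha>\<in>Poly_Mapping.keys p. smult (Poly_Mapping.lookup p \<alpha>) (\<Prod>i\<in>UNIV. [:a $ i, w $ i:] ^ (\<alpha> $ i))"
  show "\<forall>t. poly ?r t = peval p (a + t *\<^sub>R w)"
    by (simp add: peval_def poly_sum poly_prod monomial_def)
qed

text \<open>On each line through \<open>a\<close> the polynomial becomes a univariate one with
  infinitely many roots, so it vanishes everywhere; independence of the monomials then kills the
  coefficients.\<close>

lemma peval_zero_on_open:
  assumes "open U" "a \<in> U" "\<And>x. x \<in> U \<Longrightarrow> peval p x = 0"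
  shows "p = 0"
proof -
  have all: "peval p x = 0" for x
  proof -
    obtain r where r: "\<And>t. poly r t = peval p (a + t *\<^sub>R (x - a))"
      using peval_along_line by metis
    obtain e where e: "e > 0" "ball a e \<subseteq> U" using assms(1,2) open_contains_ball by blast
    \<comment> \<open>Adding 1 to the norm avoids a division by zero when
      \<open>x = a\<close>.\<close>
    define \<delta> where "\<delta> = e / (norm (x - a) + 1)"
    have \<delta>: "\<delta> > 0" using e by (auto simp: \<delta>_def intro!: divide_pos_pos add_nonneg_pos)
    have "poly r t = 0" if t: "t \<in> {0<..<\<delta>}" for t
    proof -
      have "norm (t *\<^sub>R (x - a)) \<le> t * (norm (x - a) + 1)"
        using t by (simp add: distrib_left del: scaleR_diff_right)
      also have "\<dots> < \<delta> * (norm (x - a) + 1)"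
        using t by (intro mult_strict_right_mono add_nonneg_pos) auto
      also have "\<dots> = e" by (simp add: \<delta>_def add_nonneg_eq_0_iff)
      finally have "a + t *\<^sub>R (x - a) \<in> ball a e" by (simp add: dist_norm)
      then show ?thesis using r assms(3) e by auto
    qed
    then have "{0<..<\<delta>} \<subseteq> {t. poly r t = 0}" by auto
    then have "infinite {t. poly r t = 0}"
      using \<delta> infinite_Ioo finite_subset by blast
    then have "r = 0" using poly_roots_finite by blast
    then show ?thesis using r[of 1] by simp
  qed
  have "Poly_Mapping.keys p = {}"
  proof (rule ccontr)
    assume "Poly_Mapping.keys p \<noteq> {}"
    then obtain \<alpha> where \<alpha>: "\<alpha> \<in> Poly_Mapping.keys p" by blast
    have "Poly_Mapping.lookup p \<alpha> = 0"
      by (rule monomials_independent[OF finite_keys _ \<alpha>]) (use all in \<open>simp add: peval_def\<close>)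
    with \<alpha> show False by (simp add: in_keys_iff)
  qed
  then show ?thesis by simp
qed

section \<open>Growth of forms: compactness of the sublevel set as coercivity\<close>

lemma form_bounded_by_norm:
  assumes "h \<in> forms m"
  obtains C where "C > 0" "\<And>x. \<bar>peval h x\<bar> \<le> C * norm x ^ m"
proof
  let ?C = "(\<Sum>\<alpha> | mdeg \<alpha> = m. \<bar>Poly_Mapping.lookup h \<alpha>\<bar>) + 1"
  show "?C > 0" by (intro add_nonneg_pos sum_nonneg) auto
  fix x
  have "\<bar>peval h x\<bar> \<le> (\<Sum>\<alpha> | mdeg \<alpha> = m. \<bar>Poly_Mapping.lookup h \<alpha> * monomial \<alpha> x\<bar>)"
    unfolding peval_form[OF assms] by (rule sum_abs)
  also have "\<dots> \<le> (\<Sum>\<alpha> | mdeg \<alpha> = m. \<bar>Poly_Mapping.lookup h \<alpha>\<bar> * norm x ^ m)"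
    using abs_monomial_le by (intro sum_mono) (auto simp: abs_mult intro!: mult_left_mono)
  also have "\<dots> \<le> ?C * norm x ^ m" 
    by (simp add: sum_distrib_right[symmetric] distrib_right)
  finally show "\<bar>peval h x\<bar> \<le> ?C * norm x ^ m" .
qed

text \<open>If \<open>g\<close> were nonpositive at \<open>x\<close>, homogeneity would put the
  whole ray through \<open>x\<close> into the sublevel set.\<close>

lemma compact_form_pos:
  assumes "g \<in> compact_forms m" "m > 0" "x \<noteq> 0"
  shows "peval g x > 0"
proof (rule ccontr)
  assume "\<not> peval g x > 0"
  then have neg: "peval g x \<le> 0" by simp
  have "g \<in> forms m" "bounded (sublevel g)"
    using assms(1) by (auto simp: compact_forms_def compact_imp_bounded)
  then obtain B where B: "\<And>y. y \<in> sublevel g \<Longrightarrow> norm y \<le> B" by (auto simp: bounded_iff)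
  define t where "t = (\<bar>B\<bar> + 1) / norm x"
  have t: "t \<ge> 0" by (simp add: t_def)
  have "peval g (t *\<^sub>R x) \<le> 0"
    using peval_form_scaleR[OF \<open>g \<in> forms m\<close>] neg t by (simp add: mult_nonneg_nonpos)
  then have "norm (t *\<^sub>R x) \<le> B" by (intro B) (simp add: sublevel_def)
  then show False using assms(3) by (simp add: t_def)
qed

text \<open>The constant is the minimum of \<open>g\<close> on the unit sphere; homogeneity extends
  the bound to all points.\<close>

lemma compact_form_coercive:
  fixes g :: "'n::finite rpoly"
  assumes "g \<in> compact_forms m" "m > 0"
  obtains c where "c > 0" "\<And>x. c * norm x ^ m \<le> peval g x"
proof -
  have gf: "g \<in> forms m" using assms by (simp add: compact_forms_def)
  obtain x0 where x0: "x0 \<in> sphere 0 1" "\<And>y. y \<in> sphere 0 1 \<Longrightarrow> peval g x0 \<le> peval g y"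
    using continuous_attains_inf[of "sphere 0 1 :: (real ^ 'n) set" "peval g"] continuous_on_peval
    by (metis compact_sphere sphere_eq_empty not_one_less_zero)
  show ?thesis
  proof
    have "x0 \<noteq> 0" using x0(1) by force
    then show "peval g x0 > 0" by (rule compact_form_pos[OF assms])
    fix x :: "real ^ 'n"
    show "peval g x0 * norm x ^ m \<le> peval g x"
    proof (cases "x = 0")
      case True
      then show ?thesis
        using peval_form_scaleR[OF gf, of 0 x] assms(2) by (simp add: zero_power)
    next
      case False
      have "peval g x = norm x ^ m * peval g (sgn x)"
        using peval_form_scaleR[OF gf, of "norm x" "sgn x"] False
        by (simp add: sgn_div_norm)
      moreover have "peval g x0 \<le> peval g (sgn x)"
        using False by (intro x0(2)) (simp add: norm_sgn)
      ultimately show ?thesis by (simp add: mult.commute mult_right_mono)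
    qed
  qed
qed

text \<open>The converse of \<open>compact_form_coercive\<close>. Membership in the cone is always
  proved through such a lower bound, since it survives scaling, convex combinations and small
  perturbations.\<close>

lemma coercive_form_compact:
  assumes "g \<in> forms m" "m > 0" "c > 0" "\<And>x. c * norm x ^ m \<le> peval g x"
  shows "g \<in> compact_forms m"
proof -
  have "closed (sublevel g)"
    unfolding sublevel_def by (intro closed_Collect_le continuous_intros)
  moreover have "bounded (sublevel g)"
    unfolding bounded_iff
  proof (intro exI ballI)
    fix x assume "x \<in> sublevel g"
    then have le: "c * norm x ^ m \<le> 1" using assms(4)[of x] by (simp add: sublevel_def)
    show "norm x \<le> max 1 (1 / c)"
    proof (cases "norm x \<le> 1")
      case False
      then have "norm x \<le> norm x ^ m" using assms(2) by (intro self_le_power) auto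
      also have "\<dots> \<le> 1 / c" using le assms(3) by (simp add: field_simps)
      finally show ?thesis by simp
    qed simp
  qed
  ultimately show ?thesis
    using assms(1) by (simp add: compact_forms_def compact_eq_bounded_closed)
qed

lemma compact_form_nonneg:
  assumes "g \<in> compact_forms m" "m > 0"
  shows "0 \<le> peval g x"
proof -
  obtain c where "c > 0" "c * norm x ^ m \<le> peval g x"
    using compact_form_coercive[OF assms] by blast
  moreover have "0 \<le> c * norm x ^ m" using \<open>c > 0\<close> by simp
  ultimately show ?thesis by linarith
qed

text \<open>Compares both forms with \<open>norm x ^ m\<close>. It controls \<open>g + t * h\<close>
  by \<open>g\<close> for small \<open>t\<close>, and polynomial factors in front of
  \<open>exp (- g)\<close>.\<close>

lemma form_dominated_by_compact_form:
  assumes "g \<in> compact_forms m" "m > 0" "h \<in> forms m"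
  obtains C where "C > 0" "\<And>x. \<bar>peval h x\<bar> \<le> C * peval g x"
proof -
  obtain c where c: "c > 0" "\<And>x. c * norm x ^ m \<le> peval g x"
    using compact_form_coercive[OF assms(1,2)] by blast
  obtain C where C: "C > 0" "\<And>x. \<bar>peval h x\<bar> \<le> C * norm x ^ m"
    using form_bounded_by_norm[OF assms(3)] by blast
  show ?thesis
  proof
    show "C / c > 0" using c C by simp
    fix x
    have "\<bar>peval h x\<bar> \<le> C / c * (c * norm x ^ m)" using C(2)[of x] c(1) by simp
    also have "\<dots> \<le> C / c * peval g x" using c C by (intro mult_left_mono) auto
    finally show "\<bar>peval h x\<bar> \<le> C / c * peval g x" .
  qed
qed

section \<open>The integral of \<open>exp (- g)\<close>\<close>

text \<open>Half of the exponential absorbs the power, by \<open>t ^ n / fact n \<le> exp t\<close>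
  at \<open>t = (k + 1) / 2\<close>; the other half leaves a geometric series.\<close>

lemma summable_power_times_exp_neg: "summable (\<lambda>k. (real k + 1) ^ n * exp (- real k))"
proof (rule summable_comparison_test')
  show "summable (\<lambda>k. 2 ^ n * fact n * exp (1 / 2) * exp (- 1 / 2) ^ k :: real)"
    by (intro summable_mult summable_geometric) simp
  fix k :: nat
  define t where "t = (real k + 1) / 2"
  have t: "t \<ge> 0" by (simp add: t_def)
  have two_t: "2 * t = real k + 1" by (simp add: t_def)
  have "t ^ n / fact n \<le> exp t"
    using sum_le_suminf[OF summable_exp_generic[of t], of "{n}"] t
    by (simp add: exp_def divide_inverse mult.commute)
  then have "(2 * t) ^ n \<le> 2 ^ n * fact n * exp t"
    by (simp add: power_mult_distrib divide_le_eq mult_ac)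
  then have "(2 * t) ^ n * exp (- real k) \<le> 2 ^ n * fact n * exp t * exp (- real k)"
    by (rule mult_right_mono) simp
  also have "\<dots> = 2 ^ n * fact n * exp (1 / 2) * exp (- 1 / 2) ^ k"
    by (simp add: t_def exp_of_nat_mult[symmetric] exp_add[symmetric] mult.assoc field_simps)
  finally show "norm ((real k + 1) ^ n * exp (- real k))
      \<le> 2 ^ n * fact n * exp (1 / 2) * exp (- 1 / 2) ^ k"
    by (simp add: two_t)
qed

text \<open>Where \<open>k \<le> g x < k + 1\<close>, the integrand is at most \<open>exp (- k)\<close> and \<open>x\<close> lies in a
  ball of radius proportional to \<open>k + 1\<close>.\<close>

lemma integrable_exp_neg_form:
  fixes g :: "'n::finite rpoly"
  assumes "g \<in> compact_forms m" "m > 0"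
  shows "integrable lborel (\<lambda>x. exp (- peval g x))"
proof -
  obtain c where c: "c > 0" "\<And>x. c * norm x ^ m \<le> peval g x"
    using compact_form_coercive[OF assms] by blast
  \<comment> \<open>The summand 1 serves the points of norm at most 1, the summand
    \<open>1 / c\<close> the others, where \<open>norm x \<le> norm x ^ m\<close>.\<close>
  define b where "b = 1 + 1 / c"
  have b: "b > 0" using c by (simp add: b_def add_pos_pos)
  let ?n = "CARD('n)"
  define B where "B k = cball (0 :: real ^ 'n) (b * (real k + 1))" for k :: nat
  let ?u = "\<lambda>k x. ennreal (exp (- real k)) * indicator (B k) x"
  have ptw: "ennreal (exp (- peval g x)) \<le> suminf (\<lambda>k. ?u k x)" for x
  proof -
    define k where "k = nat \<lfloor>peval g x\<rfloor>"
    have "peval g x \<ge> 0" by (rule compact_form_nonneg[OF assms])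
    then have k: "real k \<le> peval g x" "peval g x < real k + 1"
      unfolding k_def by linarith+
    have "norm x \<le> b * (real k + 1)"
    proof (cases "norm x \<le> 1")
      case True
      have "1 * 1 \<le> b * (real k + 1)" using c by (intro mult_mono) (auto simp: b_def)
      then show ?thesis using True by simp
    next
      case False
      then have "norm x \<le> norm x ^ m" using assms(2) by (intro self_le_power) auto
      also have "\<dots> \<le> (real k + 1) / c" using c(2)[of x] k c(1) by (simp add: field_simps)
      also have "\<dots> \<le> b * (real k + 1)" using c(1) by (simp add: b_def field_simps)
      finally show ?thesis .
    qed
    then have "ennreal (exp (- peval g x)) \<le> ?u k x"
      using k by (simp add: B_def ennreal_leI)
    also have "\<dots> \<le> suminf (\<lambda>k. ?u k x)"
      using sum_le_suminf[of "\<lambda>k. ?u k x" "{k}"] by (simp del: sum_mult_indicator sum_indicator_mult)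
    finally show ?thesis .
  qed
  have "(\<integral>\<^sup>+x. ennreal (exp (- peval g x)) \<partial>lborel) \<le> (\<integral>\<^sup>+x. suminf (\<lambda>k. ?u k x) \<partial>lborel)"
    by (intro nn_integral_mono ptw)
  also have "\<dots> = suminf (\<lambda>k. \<integral>\<^sup>+x. ?u k x \<partial>lborel)"
    by (intro nn_integral_suminf borel_measurable_times_ennreal borel_measurable_const
        borel_measurable_indicator) (simp add: B_def)
  also have "\<dots> = suminf (\<lambda>k. ennreal (unit_ball_vol ?n * b ^ ?n * ((real k + 1) ^ ?n * exp (- real k))))"
  proof (intro arg_cong[where f = suminf] ext)
    fix k
    have "(\<integral>\<^sup>+x. ?u k x \<partial>lborel) = ennreal (exp (- real k)) * emeasure lborel (B k)"
      by (rule nn_integral_cmult_indicator) (simp add: B_def)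
    also have "\<dots> = ennreal (exp (- real k)) * ennreal (unit_ball_vol ?n * (b * (real k + 1)) ^ ?n)"
      using b by (simp add: B_def emeasure_cball)
    finally show "(\<integral>\<^sup>+x. ?u k x \<partial>lborel)
        = ennreal (unit_ball_vol ?n * b ^ ?n * ((real k + 1) ^ ?n * exp (- real k)))"
      using b by (simp add: ennreal_mult[symmetric] power_mult_distrib mult_ac)
  qed
  also have "\<dots> < \<infinity>"
    using b summable_power_times_exp_neg[of ?n]
    by (simp add: less_top[symmetric] ennreal_suminf_neq_top summable_mult)
  finally show ?thesis by (intro integrableI_nonneg) auto
qed

lemma compact_form_scale:
  assumes "g \<in> compact_forms m" "m > 0" "a > 0"
  obtains f where "f \<in> compact_forms m" "\<And>x. peval f x = a * peval g x"
proof -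
  have gf: "g \<in> forms m" using assms by (simp add: compact_forms_def)
  define f where
    "f = form_of m (\<lambda>\<alpha>. a * Poly_Mapping.lookup g \<alpha> + 0 * Poly_Mapping.lookup g \<alpha>)"
  have f: "f \<in> forms m" "peval f x = a * peval g x" for x
    unfolding f_def peval_form_combination[OF gf gf] by (simp_all add: form_of_in_forms)
  obtain c where c: "c > 0" "\<And>x. c * norm x ^ m \<le> peval g x"
    using compact_form_coercive[OF assms(1,2)] by blast
  have "f \<in> compact_forms m"
    using c f assms by (intro coercive_form_compact[of _ _ "a * c"]) (auto simp: mult.assoc)
  with f(2) show ?thesis by (intro that) auto
qed

text \<open>With \<open>f = g / 2\<close>, one factor \<open>exp (- f)\<close> absorbs
  \<open>h\<close>, because \<open>\<bar>h\<bar> \<le> 2 * C * f\<close> and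
  \<open>f * exp (- f) \<le> 1\<close>; the other factor is integrable.\<close>

lemma integrable_form_exp_neg:
  assumes "g \<in> compact_forms m" "m > 0" "h \<in> forms m"
  shows "integrable lborel (\<lambda>x. peval h x * exp (- peval g x))"
proof -
  obtain C where C: "C > 0" "\<And>x. \<bar>peval h x\<bar> \<le> C * peval g x"
    using form_dominated_by_compact_form[OF assms] by blast
  obtain f where f: "f \<in> compact_forms m" "\<And>x. peval f x = 1 / 2 * peval g x"
    using compact_form_scale[OF assms(1,2), of "1 / 2"] by auto
  show ?thesis
  proof (rule Bochner_Integration.integrable_bound)
    show "integrable lborel (\<lambda>x. 2 * C * exp (- peval f x))"
      by (intro integrable_mult_right integrable_exp_neg_form[OF f(1) assms(2)])
    show "AE x in lborel. norm (peval h x * exp (- peval g x)) \<le> norm (2 * C * exp (- peval f x))"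
    proof (rule AE_I2)
      fix x
      have "peval f x \<le> exp (peval f x)" using exp_ge_add_one_self[of "peval f x"] by linarith
      then have "peval f x * exp (- peval f x) \<le> 1" by (simp add: exp_minus field_simps)
      then have le: "2 * C * (peval f x * exp (- peval f x)) * exp (- peval f x)
          \<le> 2 * C * 1 * exp (- peval f x)"
        using C by (intro mult_right_mono mult_left_mono) auto
      have gE: "exp (- peval g x) = exp (- peval f x) * exp (- peval f x)"
        by (simp add: f exp_add[symmetric])
      have "\<bar>peval h x\<bar> * exp (- peval g x) \<le> C * (2 * peval f x) * exp (- peval g x)"
        using C(2)[of x] by (intro mult_right_mono) (auto simp: f)
      also have "\<dots> = 2 * C * (peval f x * exp (- peval f x)) * exp (- peval f x)"
        by (simp only: gE mult_ac)
      also note le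
      finally show "norm (peval h x * exp (- peval g x)) \<le> norm (2 * C * exp (- peval f x))"
        using C by (simp add: abs_mult)
    qed
  qed simp
qed

section \<open>Scaling and first-order inequalities for the objective\<close>

lemma lborel_integral_scaleR:
  fixes F :: "'a::euclidean_space \<Rightarrow> real"
  assumes [measurable]: "F \<in> borel_measurable borel" and "c > 0"
  shows "(LINT x|lborel. F (c *\<^sub>R x)) = (LINT x|lborel. F x) / c ^ DIM('a)"
proof -
  have "(LINT x|lborel. F x)
      = (LINT x|density (distr lborel borel (\<lambda>x. 0 + c *\<^sub>R x)) (\<lambda>_. \<bar>c\<bar> ^ DIM('a)). F x)"
    using assms(2) by (subst lborel_affine[of c 0]) auto
  also have "\<dots> = (LINT x|lborel. c ^ DIM('a) * F (c *\<^sub>R x))"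
    using assms(2) by (subst integral_density) (auto simp: integral_distr)
  finally show ?thesis using assms(2) by simp
qed

lemma exp_tangent: "exp a * (1 + (b - a)) \<le> exp (b :: real)"
proof -
  have "exp a * (1 + (b - a)) \<le> exp a * exp (b - a)"
    by (intro mult_left_mono exp_ge_add_one_self) simp
  then show ?thesis by (simp add: exp_add[symmetric])
qed

text \<open>By homogeneity \<open>\<integral> exp (- t g) = t powr (- n / m) * \<integral> exp (- g)\<close>, and the tangent line of
  \<open>exp\<close> bounds this convex function of \<open>t\<close> from below with equality at \<open>t = 1\<close>;
  comparing slopes there gives the identity.\<close>

lemma integral_form_exp_neg_self:
  fixes g :: "'n::finite rpoly"
  assumes "g \<in> compact_forms m" "m > 0"
  shows "(LINT x|lborel. peval g x * exp (- peval g x)) = real CARD('n) / real m * objective g"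
proof -
  have gf: "g \<in> forms m" using assms by (simp add: compact_forms_def)
  define I where "I = objective g"
  define J where "J = (LINT x|lborel. peval g x * exp (- peval g x))"
  define p where "p = - (real CARD('n) / real m)"
  have int: "integrable lborel (\<lambda>x. exp (- peval g x))"
    "integrable lborel (\<lambda>x. peval g x * exp (- peval g x))"
    using integrable_exp_neg_form[OF assms] integrable_form_exp_neg[OF assms gf] by auto
  have le: "I \<le> t powr p * I + (t - 1) * J" if "t > 0" for t
  proof -
    \<comment> \<open>The \<open>m\<close>-th root of \<open>t\<close>, so that
      \<open>g (c x) = t * g x\<close>.\<close>
    define c where "c = t powr (1 / real m)"
    have c: "c > 0" using that by (simp add: c_def)
    have cm: "c ^ m = t"
      using that assms(2) by (simp add: c_def powr_realpow[symmetric] powr_powr)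
    have cn: "1 / c ^ CARD('n) = t powr p"
      using that by (simp add: c_def p_def powr_realpow[symmetric] powr_powr powr_minus_divide)
    have eq: "(LINT x|lborel. exp (- (t * peval g x))) = t powr p * I"
      using lborel_integral_scaleR[of "\<lambda>x. exp (- peval g x)" c] c
      by (simp add: peval_form_scaleR[OF gf] cm I_def objective_def cn[symmetric])
    obtain f where f: "f \<in> compact_forms m" "\<And>x. peval f x = t * peval g x"
      using compact_form_scale[OF assms \<open>t > 0\<close>] by blast
    have "I - (t - 1) * J
        = (LINT x|lborel. exp (- peval g x) - (t - 1) * (peval g x * exp (- peval g x)))"
      using int by (simp add: I_def J_def objective_def)
    also have "\<dots> \<le> (LINT x|lborel. exp (- (t * peval g x)))"
    proof (rule integral_mono)
      show "integrable lborel (\<lambda>x. exp (- (t * peval g x)))"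
        using integrable_exp_neg_form[OF f(1) assms(2)] by (simp add: f(2))
      show "exp (- peval g x) - (t - 1) * (peval g x * exp (- peval g x)) \<le> exp (- (t * peval g x))"
        for x
        using exp_tangent[of "- peval g x" "- (t * peval g x)"] by (simp add: algebra_simps)
    qed (use int in auto)
    finally show ?thesis by (simp add: eq)
  qed
  have "((\<lambda>t. t powr p * I + (t - 1) * J) has_real_derivative p * I + J) (at 1)"
    by (auto intro!: derivative_eq_intros)
  \<comment> \<open>At 1 the bound \<open>le\<close> is an equality, so 1 is a local minimum; radius
    1 keeps \<open>t\<close> positive.\<close>
  then have "p * I + J = 0"
    by (rule DERIV_local_min[where d = 1]) (use le in auto)
  then show ?thesis by (simp add: p_def I_def J_def)
qed

text \<open>The pointwise inequality \<open>exp_tangent\<close>, integrated. The gradient is the one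
  at \<open>f\<close>.\<close>

lemma objective_gradient_ineq:
  assumes "f \<in> compact_forms m" "g \<in> compact_forms m" "m > 0"
  shows "(LINT x|lborel. peval f x * exp (- peval f x))
      - (LINT x|lborel. peval g x * exp (- peval f x)) \<le> objective g - objective f"
proof -
  have gf: "f \<in> forms m" "g \<in> forms m" using assms by (simp_all add: compact_forms_def)
  have int: "integrable lborel (\<lambda>x. exp (- peval f x))"
    "integrable lborel (\<lambda>x. peval f x * exp (- peval f x))"
    "integrable lborel (\<lambda>x. peval g x * exp (- peval f x))"
    using assms gf integrable_exp_neg_form integrable_form_exp_neg by auto
  have "(LINT x|lborel. exp (- peval f x)
      + (peval f x * exp (- peval f x) - peval g x * exp (- peval f x))) \<le> objective g"
    unfolding objective_def
  proof (rule integral_mono)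
    show "exp (- peval f x) + (peval f x * exp (- peval f x) - peval g x * exp (- peval f x))
        \<le> exp (- peval g x)" for x
      using exp_tangent[of "- peval f x" "- peval g x"] by (simp add: algebra_simps)
  qed (use int assms integrable_exp_neg_form in auto)
  with int show ?thesis by (simp add: objective_def)
qed

text \<open>The gradient inequality at the perturbed form \<open>f j\<close> reads \<open>t j *
  \<integral> h exp (- f j) \<le> objective g - objective (f j)\<close>. By dominated convergence
  the integral on the left tends to the positive one at \<open>g\<close>, so it is positive for some
  \<open>j\<close>.\<close>

lemma objective_descent:
  assumes "g \<in> compact_forms m" "m > 0" "h \<in> forms m" "s > 0"
    and pos: "(LINT x|lborel. peval h x * exp (- peval g x)) > 0"
  obtains t f where "0 < t" "t \<le> s" "f \<in> compact_forms m"
    "\<And>x. peval f x = peval g x + t * peval h x" "objective f < objective g"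
proof -
  have gf: "g \<in> forms m" using assms by (simp add: compact_forms_def)
  obtain C where C: "C > 0" "\<And>x. \<bar>peval h x\<bar> \<le> C * peval g x"
    using form_dominated_by_compact_form[OF assms(1-3)] by blast
  obtain c where c: "c > 0" "\<And>x. c * norm x ^ m \<le> peval g x"
    using compact_form_coercive[OF assms(1,2)] by blast
  \<comment> \<open>Steps of size at most \<open>1 / (2 * C)\<close> keep \<open>f j\<close> above
    \<open>g / 2\<close>, which yields both coercivity and an integrable majorant.\<close>
  define r where "r = min s (1 / (2 * C))"
  define t where "t j = r / real (Suc j)" for j
  have r: "r > 0" "r \<le> s" using assms(4) C by (auto simp: r_def)
  have t: "0 < t j" "t j \<le> r" for j
    using r by (auto simp: t_def divide_le_eq mult_le_cancel_left1)
  have tC: "t j * C \<le> 1 / 2" for j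
  proof -
    have "t j * C \<le> 1 / (2 * C) * C"
      using t(2)[of j] C by (intro mult_right_mono) (auto simp: r_def)
    then show ?thesis using C by simp
  qed
  define f where
    "f j = form_of m (\<lambda>\<alpha>. 1 * Poly_Mapping.lookup g \<alpha> + t j * Poly_Mapping.lookup h \<alpha>)" for j
  have f: "f j \<in> forms m" "peval (f j) x = peval g x + t j * peval h x" for j x
    unfolding f_def peval_form_combination[OF gf assms(3)] by (simp_all add: form_of_in_forms)
  have half: "1 / 2 * peval g x \<le> peval (f j) x" for j x
  proof -
    have "t j * (- peval h x) \<le> t j * \<bar>peval h x\<bar>"
      using t(1)[of j] by (intro mult_left_mono) auto
    also have "\<dots> \<le> t j * (C * peval g x)" using t(1)[of j] C by (intro mult_left_mono) auto
    also have "\<dots> \<le> 1 / 2 * peval g x"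
      using mult_right_mono[OF tC[of j] compact_form_nonneg[OF assms(1,2), of x]]
      by (simp add: mult_ac)
    finally show ?thesis by (simp add: f)
  qed
  have fc: "f j \<in> compact_forms m" for j
  proof (rule coercive_form_compact[OF f(1) assms(2)])
    show "c / 2 > 0" using c by simp
    show "c / 2 * norm x ^ m \<le> peval (f j) x" for x
      using half[of x j] c(2)[of x] by simp
  qed
  \<comment> \<open>Half of \<open>g\<close>, whose exponential gives the majorant
    \<open>C * g * exp (- g / 2)\<close>, independent of \<open>j\<close>.\<close>
  obtain e where e: "e \<in> compact_forms m" "\<And>x. peval e x = 1 / 2 * peval g x"
    using compact_form_scale[OF assms(1,2), of "1 / 2"] by auto
  have t0: "t \<longlonglongrightarrow> 0"
    unfolding t_def using LIMSEQ_Suc[OF lim_const_over_n[of r]] by simp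
  have "(\<lambda>j. LINT x|lborel. peval h x * exp (- peval (f j) x))
      \<longlonglongrightarrow> (LINT x|lborel. peval h x * exp (- peval g x))"
  proof (rule integral_dominated_convergence)
    show "integrable lborel (\<lambda>x. C * (peval g x * exp (- peval e x)))"
      by (intro integrable_mult_right integrable_form_exp_neg[OF e(1) assms(2) gf])
    show "AE x in lborel. (\<lambda>j. peval h x * exp (- peval (f j) x))
        \<longlonglongrightarrow> peval h x * exp (- peval g x)"
    proof (rule AE_I2)
      fix x
      have "(\<lambda>j. peval h x * exp (- (peval g x + t j * peval h x)))
          \<longlonglongrightarrow> peval h x * exp (- (peval g x + 0 * peval h x))"
        by (intro tendsto_intros t0)
      then show "(\<lambda>j. peval h x * exp (- peval (f j) x)) \<longlonglongrightarrow> peval h x * exp (- peval g x)"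
        by (simp add: f)
    qed
    show "AE x in lborel. norm (peval h x * exp (- peval (f j) x))
        \<le> C * (peval g x * exp (- peval e x))" for j
    proof (rule AE_I2)
      fix x
      have "\<bar>peval h x\<bar> * exp (- peval (f j) x) \<le> (C * peval g x) * exp (- peval e x)"
        using C half[of x j] compact_form_nonneg[OF assms(1,2), of x]
        by (intro mult_mono) (auto simp: e(2))
      then show "norm (peval h x * exp (- peval (f j) x)) \<le> C * (peval g x * exp (- peval e x))"
        by (simp add: abs_mult mult_ac)
    qed
  qed simp_all
  then have "\<forall>\<^sub>F j in sequentially. 0 < (LINT x|lborel. peval h x * exp (- peval (f j) x))"
    using pos by (rule order_tendstoD)
  then obtain j where j: "0 < (LINT x|lborel. peval h x * exp (- peval (f j) x))"
    by (auto simp: eventually_sequentially)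
  have "t j * (LINT x|lborel. peval h x * exp (- peval (f j) x))
      = (LINT x|lborel. peval (f j) x * exp (- peval (f j) x) - peval g x * exp (- peval (f j) x))"
    by (simp add: f(2)[of j] algebra_simps flip: integral_mult_right_zero)
  also have "\<dots> = (LINT x|lborel. peval (f j) x * exp (- peval (f j) x))
      - (LINT x|lborel. peval g x * exp (- peval (f j) x))"
    by (intro Bochner_Integration.integral_diff integrable_form_exp_neg[OF fc assms(2)] f gf)
  also have "\<dots> \<le> objective g - objective (f j)"
    by (rule objective_gradient_ineq[OF fc assms(1,2)])
  finally have "objective (f j) < objective g"
    using mult_pos_pos[OF t(1)[of j] j] by linarith
  with t[of j] r(2) show ?thesis by (intro that[of "t j" "f j"] fc f(2)) auto
qed

section \<open>Positive semidefinite matrices and closed cones\<close>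

lemma quad_form_insert:
  fixes Q :: "'i \<Rightarrow> 'i \<Rightarrow> real"
  assumes "finite I" "i \<notin> I" "\<And>j. j \<in> I \<Longrightarrow> Q j i = Q i j"
  shows "(\<Sum>j\<in>insert i I. \<Sum>k\<in>insert i I. v j * Q j k * v k)
    = (v i)\<^sup>2 * Q i i + 2 * v i * (\<Sum>j\<in>I. Q i j * v j) + (\<Sum>j\<in>I. \<Sum>k\<in>I. v j * Q j k * v k)"
proof -
  have "(\<Sum>j\<in>I. v j * Q j i * v i) = v i * (\<Sum>j\<in>I. Q i j * v j)"
    by (simp add: sum_distrib_left assms(3) mult_ac)
  moreover have "(\<Sum>k\<in>I. v i * Q i k * v k) = v i * (\<Sum>j\<in>I. Q i j * v j)"
    by (simp add: sum_distrib_left mult_ac)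
  ultimately show ?thesis
    using assms(1,2) by (simp add: sum.distrib power2_eq_square algebra_simps)
qed

text \<open>Cholesky decomposition: the first square is \<open>(\<Sum>j. Q i j * v j)\<^sup>2 / Q i i\<close>. If
  \<open>Q i i = 0\<close>, division by zero makes this square vanish, as it should, since then row \<open>i\<close>
  is zero.\<close>

lemma psd_on_sum_of_squares:
  assumes "finite I" "psd_on I Q"
  shows "\<exists>vs. \<forall>i\<in>I. \<forall>j\<in>I. Q i j = (\<Sum>v\<leftarrow>vs. v i * v j)"
  using assms
proof (induction I arbitrary: Q rule: finite_induct)
  case empty
  then show ?case by simp
next
  case (insert i I)
  have sym: "Q j k = Q k j" if "j \<in> insert i I" "k \<in> insert i I" for j k
    using insert.prems that by (auto simp: psd_on_def)
  have psd: "0 \<le> (v i)\<^sup>2 * Q i i + 2 * v i * (\<Sum>j\<in>I. Q i j * v j)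
      + (\<Sum>j\<in>I. \<Sum>k\<in>I. v j * Q j k * v k)" for v
    using insert.prems sym
    unfolding psd_on_def by (subst quad_form_insert[OF insert.hyps, symmetric]) auto
  \<comment> \<open>The entry of the test vector at \<open>i\<close> becomes a free variable
    \<open>s\<close>, independent of the entries on \<open>I\<close>.\<close>
  have upd: "0 \<le> s\<^sup>2 * Q i i + 2 * s * (\<Sum>j\<in>I. Q i j * v j)
      + (\<Sum>j\<in>I. \<Sum>k\<in>I. v j * Q j k * v k)" for s v
  proof -
    have "(v(i := s)) j = v j" if "j \<in> I" for j using that insert.hyps by auto
    then show ?thesis using psd[of "v(i := s)"] by (simp cong: sum.cong)
  qed
  have a: "Q i i \<ge> 0"
    using upd[of 1 "\<lambda>_. 0"] by simp
  have row: "Q i j = 0" if "Q i i = 0" "j \<in> I" for j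
  proof (rule ccontr)
    assume nz: "Q i j \<noteq> 0"
    let ?v = "\<lambda>k. if k = j then 1 else (0 :: real)"
    have "(\<Sum>k\<in>I. Q i k * ?v k) = (\<Sum>k\<in>I. if k = j then Q i k else 0)"
      by (rule sum.cong) auto
    then have 1: "(\<Sum>k\<in>I. Q i k * ?v k) = Q i j" using that(2) insert.hyps by simp
    have "(\<Sum>k\<in>I. \<Sum>l\<in>I. ?v k * Q k l * ?v l)
        = (\<Sum>k\<in>I. \<Sum>l\<in>I. if l = j then (if k = j then Q k l else 0) else 0)"
      by (intro sum.cong) auto
    then have 2: "(\<Sum>k\<in>I. \<Sum>l\<in>I. ?v k * Q k l * ?v l) = Q j j"
      using that(2) insert.hyps by simp
    \<comment> \<open>The test vector has the entry 1 at \<open>j\<close> and this quotient at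
      \<open>i\<close>; as \<open>Q i i = 0\<close>, the quadratic form would take the value
      -1.\<close>
    have "0 \<le> 2 * (- (Q j j + 1) / (2 * Q i j)) * Q i j + Q j j"
      using upd[of "- (Q j j + 1) / (2 * Q i j)" ?v] that(1) unfolding 1 2 by simp
    with nz show False by (simp add: field_simps)
  qed
  define u where "u j = Q i j / sqrt (Q i i)" for j
  have ui: "Q i j = u i * u j" if "j \<in> insert i I" for j
    using a row that by (cases "Q i i = 0") (auto simp: u_def)
  define R where "R j k = Q j k - u j * u k" for j k
  have "psd_on I R"
    unfolding psd_on_def
  proof (intro conjI ballI allI)
    show "R j k = R k j" if "j \<in> I" "k \<in> I" for j k
      using sym that by (simp add: R_def)
    fix v
    define L where "L = (\<Sum>j\<in>I. Q i j * v j)"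
    have "(\<Sum>j\<in>I. u j * v j) = L / sqrt (Q i i)"
      by (simp add: u_def L_def sum_divide_distrib)
    then have "(\<Sum>j\<in>I. u j * v j)\<^sup>2 = L\<^sup>2 / Q i i" using a by (simp add: power_divide)
    moreover have "(\<Sum>j\<in>I. \<Sum>k\<in>I. v j * R j k * v k)
        = (\<Sum>j\<in>I. \<Sum>k\<in>I. v j * Q j k * v k) - (\<Sum>j\<in>I. u j * v j)\<^sup>2"
      unfolding R_def power2_eq_square sum_product
      by (simp add: algebra_simps sum_subtractf)
    \<comment> \<open>Schur complement: \<open>s = - L / Q i i\<close> minimises the quadratic
      polynomial in \<open>s\<close> of \<open>upd\<close>.\<close>
    moreover have "0 \<le> (\<Sum>j\<in>I. \<Sum>k\<in>I. v j * Q j k * v k) - L\<^sup>2 / Q i i"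
    proof (cases "Q i i = 0")
      case True
      then show ?thesis using upd[of 0 v] by simp
    next
      case False
      then have "(- L / Q i i)\<^sup>2 * Q i i + 2 * (- L / Q i i) * L = - (L\<^sup>2 / Q i i)"
        by (simp add: power2_eq_square)
      then show ?thesis using upd[of "- L / Q i i" v] unfolding L_def[symmetric] by linarith
    qed
    ultimately show "0 \<le> (\<Sum>j\<in>I. \<Sum>k\<in>I. v j * R j k * v k)" by simp
  qed
  from insert.IH[OF this] obtain vs where
    vs: "\<And>j k. j \<in> I \<Longrightarrow> k \<in> I \<Longrightarrow> R j k = (\<Sum>v\<leftarrow>vs. v j * v k)" by blast
  \<comment> \<open>The vector \<open>u\<close> alone accounts for row and column \<open>i\<close>,
    so the others are set to 0 there.\<close>
  let ?vs = "u # map (\<lambda>v. v(i := 0)) vs"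
  have "Q j k = (\<Sum>v\<leftarrow>?vs. v j * v k)" if jk: "j \<in> insert i I" "k \<in> insert i I" for j k
  proof -
    consider "j = i" | "k = i" | "j \<in> I" "k \<in> I" "j \<noteq> i" "k \<noteq> i" using jk by blast
    then show ?thesis
    proof cases
      case 1
      then show ?thesis using ui[OF jk(2)] by (simp add: o_def)
    next
      case 2
      then show ?thesis using ui[OF jk(1)] sym[OF jk] by (simp add: o_def mult.commute)
    next
      case 3
      then show ?thesis using vs[of j k] by (simp add: o_def R_def)
    qed
  qed
  then show ?case by blast
qed

text \<open>A sum of rank-one matrices gives a sum of squares. Here \<open>m\<close> stands for the
  monomials at a point as well as for a test vector.\<close>

lemma quad_form_sum_list:
  fixes m :: "'i \<Rightarrow> real"
  shows "(\<Sum>i\<in>I. \<Sum>j\<in>I. (\<Sum>v\<leftarrow>vs. f v i * f v j) * (m i * m j))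
    = (\<Sum>v\<leftarrow>vs. (\<Sum>i\<in>I. f v i * m i)\<^sup>2)"
proof (induction vs)
  case (Cons v vs)
  have "(\<Sum>i\<in>I. f v i * m i)\<^sup>2 = (\<Sum>i\<in>I. \<Sum>j\<in>I. (f v i * f v j) * (m i * m j))"
    by (simp add: power2_eq_square sum_product mult_ac)
  with Cons show ?case by (simp add: distrib_right sum.distrib)
qed simp

text \<open>Moving from the nearest point \<open>a\<close> in a direction that stays in
  \<open>A\<close> cannot decrease the distance to first order. The directions in \<open>A\<close>
  give the first claim; the direction \<open>- a\<close>, which passes through
  \<open>(1 - t) * a\<close>, gives the second.\<close>

lemma nearest_point_of_cone_separates:
  fixes a y :: "'j \<Rightarrow> real"
  assumes "a \<in> A"
    and nearest: "\<And>b. b \<in> A \<Longrightarrow> (\<Sum>j\<in>J. (a j - y j)\<^sup>2) \<le> (\<Sum>j\<in>J. (b j - y j)\<^sup>2)"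
    and add: "\<And>b c. b \<in> A \<Longrightarrow> c \<in> A \<Longrightarrow> (\<lambda>j. b j + c j) \<in> A"
    and scale: "\<And>b t. b \<in> A \<Longrightarrow> t \<ge> 0 \<Longrightarrow> (\<lambda>j. t * b j) \<in> A"
  shows "\<And>b. b \<in> A \<Longrightarrow> (\<Sum>j\<in>J. (y j - a j) * b j) \<le> 0"
    and "(\<Sum>j\<in>J. (y j - a j)\<^sup>2) \<le> (\<Sum>j\<in>J. (y j - a j) * y j)"
proof -
  have key: "(\<Sum>j\<in>J. (y j - a j) * b j) \<le> 0"
    if "\<And>t. 0 < t \<Longrightarrow> t \<le> 1 \<Longrightarrow> (\<lambda>j. a j + t * b j) \<in> A" for b
  proof (rule ccontr)
    define p where "p = (\<Sum>j\<in>J. (y j - a j) * b j)"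
    define q where "q = (\<Sum>j\<in>J. (b j)\<^sup>2)"
    assume "\<not> (\<Sum>j\<in>J. (y j - a j) * b j) \<le> 0"
    then have p: "p > 0" by (simp add: p_def)
    have q: "q \<ge> 0" by (simp add: q_def sum_nonneg)
    \<comment> \<open>Small enough that the gain \<open>2 * t * p\<close> outweighs the second-order
      term \<open>t\<^sup>2 * q\<close>.\<close>
    define t where "t = min 1 (p / (q + 1))"
    have t: "0 < t" "t \<le> 1" using p q by (auto simp: t_def)
    have "(\<Sum>j\<in>J. (a j + t * b j - y j)\<^sup>2) = (\<Sum>j\<in>J. (a j - y j)\<^sup>2) - 2 * t * p + t\<^sup>2 * q"
      unfolding p_def q_def sum_distrib_left
      by (simp add: sum.distrib[symmetric] sum_subtractf[symmetric] power2_eq_square algebra_simps)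
    with nearest[OF that[OF t]] have "2 * t * p \<le> t\<^sup>2 * q" by simp
    then have "2 * p \<le> t * q" using t by (simp add: power2_eq_square)
    also have "\<dots> \<le> p / (q + 1) * q" using q by (intro mult_right_mono) (auto simp: t_def)
    also have "\<dots> \<le> p" using p q by (simp add: field_simps)
    finally show False using p by simp
  qed
  show "(\<Sum>j\<in>J. (y j - a j) * b j) \<le> 0" if "b \<in> A" for b
    by (rule key) (use add[OF assms(1) scale[OF that]] in auto)
  have "(\<Sum>j\<in>J. (y j - a j) * (- a j)) \<le> 0"
  proof (rule key)
    fix t :: real assume "0 < t" "t \<le> 1"
    then show "(\<lambda>j. a j + t * - a j) \<in> A"
      using scale[OF assms(1), of "1 - t"] by (simp add: algebra_simps)
  qed
  then show "(\<Sum>j\<in>J. (y j - a j)\<^sup>2) \<le> (\<Sum>j\<in>J. (y j - a j) * y j)"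
    by (simp add: power2_eq_square right_diff_distrib sum_subtractf sum_negf)
qed

text \<open>Tychonoff's theorem for functions on a type. Coefficient functions and Gram matrices are
  indexed by infinitely many exponents, so coordinatewise bounds have to suffice for
  compactness.\<close>

lemma compact_PiE_UNIV:
  fixes S :: "'i \<Rightarrow> 'a::topological_space set"
  assumes "\<And>i. compact (S i)"
  shows "compact (PiE UNIV S)"
  using assms compactin_PiE[of "\<lambda>_. euclidean" UNIV S]
  by (simp add: euclidean_product_topology)

lemma continuous_on_coordinate [continuous_intros]: "continuous_on S (\<lambda>v. v i)"
  by (rule continuous_on_subset[OF continuous_on_product_coordinates]) simp

section \<open>Localizing matrices and sums of squares\<close>

locale moment_setting =
  fixes K :: "(real ^ 'n::finite) set" and \<mu> :: "(real ^ 'n) measure"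
  assumes compact_K: "compact K" and interior_K: "interior K \<noteq> {}"
    and sets_\<mu>: "sets \<mu> = sets borel" and finite_\<mu>: "finite_measure \<mu>"
    and support_\<mu>: "msupport \<mu> = K"
begin

lemma space_\<mu> [simp]: "space \<mu> = UNIV"
  using sets_eq_imp_space_eq[OF sets_\<mu>] by simp

lemma borel_measurable_\<mu>: "f \<in> borel_measurable borel \<Longrightarrow> f \<in> borel_measurable \<mu>"
  using measurable_cong_sets[OF sets_\<mu> refl] by blast

text \<open>The complement of the support is a union of open null sets; the Lindelof property makes
  the union countable, hence null.\<close>

lemma AE_in_K: "AE x in \<mu>. x \<in> K"
proof -
  let ?F = "{U. open U \<and> emeasure \<mu> U = 0}"
  obtain F where F: "F \<subseteq> ?F" "countable F" "\<Union>F = \<Union>?F"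
    using Lindelof[of ?F] by auto
  have "(\<Union>U\<in>F. U) \<in> null_sets \<mu>"
    using F(1,2) sets_\<mu> by (intro null_sets_UN') (auto simp: null_sets_def)
  moreover have "{x \<in> space \<mu>. x \<notin> K} \<subseteq> (\<Union>U\<in>F. U)"
  proof
    fix x assume "x \<in> {x \<in> space \<mu>. x \<notin> K}"
    then have "x \<notin> msupport \<mu>" using support_\<mu> by simp
    then have "x \<in> \<Union>?F" by (auto simp: msupport_def not_gr_zero)
    then show "x \<in> (\<Union>U\<in>F. U)" using F(3) by simp
  qed
  ultimately show ?thesis by (rule AE_I')
qed

section \<open>Integration of continuous functions over K\<close>

definition integ :: "(real ^ 'n \<Rightarrow> real) \<Rightarrow> real" where
  "integ f = (LINT x:K|\<mu>. f x)"

text \<open>Reduces the integrability conditions on \<open>K\<close> to continuity, which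
  \<open>continuous_intros\<close> proves for all integrands below.\<close>

lemma set_integrable_continuous:
  assumes "continuous_on UNIV f"
  shows "set_integrable \<mu> K (f :: real ^ 'n \<Rightarrow> real)"
proof -
  have "compact (f ` K)"
    using assms compact_K by (intro compact_continuous_image) (auto intro: continuous_on_subset)
  then obtain B where B: "\<And>x. x \<in> K \<Longrightarrow> \<bar>f x\<bar> \<le> B"
    using compact_imp_bounded bounded_iff by (metis imageI real_norm_def)
  have "K \<in> sets borel" using compact_K by (simp add: compact_imp_closed)
  then have "(\<lambda>x. indicator K x *\<^sub>R f x) \<in> borel_measurable \<mu>"
    using borel_measurable_continuous_onI[OF assms] by (intro borel_measurable_\<mu>) simp
  moreover have "AE x in \<mu>. norm (indicator K x *\<^sub>R f x) \<le> \<bar>B\<bar>"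
    using B by (intro AE_I2) (force simp: indicator_def)
  ultimately show ?thesis
    unfolding set_integrable_def by (intro finite_measure.integrable_const_bound[OF finite_\<mu>])
qed

lemma integ_add:
  "continuous_on UNIV f \<Longrightarrow> continuous_on UNIV g \<Longrightarrow> integ (\<lambda>x. f x + g x) = integ f + integ g"
  unfolding integ_def by (intro set_integral_add(2) set_integrable_continuous)

lemma integ_diff:
  "continuous_on UNIV f \<Longrightarrow> continuous_on UNIV g \<Longrightarrow> integ (\<lambda>x. f x - g x) = integ f - integ g"
  unfolding integ_def by (intro set_integral_diff(2) set_integrable_continuous)

lemma integ_cmult: "integ (\<lambda>x. c * f x) = c * integ f"
  unfolding integ_def by simp

lemma integ_sum:
  assumes "\<And>i. i \<in> A \<Longrightarrow> continuous_on UNIV (f i)"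
  shows "integ (\<lambda>x. \<Sum>i\<in>A. f i x) = (\<Sum>i\<in>A. integ (f i))"
  using assms
proof (induction A rule: infinite_finite_induct)
  case (insert i A)
  have "integ (\<lambda>x. f i x + (\<Sum>i\<in>A. f i x)) = integ (f i) + integ (\<lambda>x. \<Sum>i\<in>A. f i x)"
    using insert.prems by (intro integ_add continuous_on_sum) auto
  with insert show ?case by simp
qed (simp_all add: integ_def set_lebesgue_integral_def)

lemma integ_sum_list:
  assumes "\<And>q. q \<in> set qs \<Longrightarrow> continuous_on UNIV (f q)"
  shows "integ (\<lambda>x. \<Sum>q\<leftarrow>qs. f q x) = (\<Sum>q\<leftarrow>qs. integ (f q))"
  using assms
proof (induction qs)
  case (Cons q qs)
  have "continuous_on UNIV (\<lambda>x. \<Sum>q\<leftarrow>qs. f q x)"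
    using Cons.prems by (induction qs) (auto intro!: continuous_intros)
  then have "integ (\<lambda>x. f q x + (\<Sum>q\<leftarrow>qs. f q x)) = integ (f q) + integ (\<lambda>x. \<Sum>q\<leftarrow>qs. f q x)"
    using Cons.prems by (intro integ_add) auto
  with Cons show ?case by simp
qed (simp add: integ_def set_lebesgue_integral_def)

lemma integ_nonneg: "(\<And>x. x \<in> K \<Longrightarrow> 0 \<le> f x) \<Longrightarrow> 0 \<le> integ f"
  unfolding integ_def set_lebesgue_integral_def
  by (intro integral_nonneg_AE AE_I2) (auto simp: indicator_def)

text \<open>A zero integral would make the open set where \<open>f\<close> is positive a null set,
  although it contains the point \<open>a\<close> of the support.\<close>

lemma integ_pos:
  assumes "continuous_on UNIV f" "\<And>x. x \<in> K \<Longrightarrow> 0 \<le> f x" "a \<in> K" "f a > 0"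
  shows "integ f > 0"
proof (rule ccontr)
  assume "\<not> integ f > 0"
  then have 0: "integ f = 0" using integ_nonneg[of f] assms(2) by fastforce
  have "AE x in \<mu>. indicator K x *\<^sub>R f x = 0"
  proof (rule integral_nonneg_eq_0_iff_AE[THEN iffD1])
    show "integrable \<mu> (\<lambda>x. indicator K x *\<^sub>R f x)"
      using set_integrable_continuous[OF assms(1)] by (simp add: set_integrable_def)
    show "AE x in \<mu>. 0 \<le> indicator K x *\<^sub>R f x"
      using assms(2) by (intro AE_I2) (auto simp: indicator_def)
    show "(LINT x|\<mu>. indicator K x *\<^sub>R f x) = 0"
      using 0 by (simp add: integ_def set_lebesgue_integral_def)
  qed
  with AE_in_K have ae: "AE x in \<mu>. x \<notin> {x. 0 < f x}"
    by eventually_elim auto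
  have op: "open {x. 0 < f x}"
    using assms(1) by (intro open_Collect_less continuous_intros)
  then have "emeasure \<mu> {x. 0 < f x} = 0"
    using ae sets_\<mu> by (subst (asm) AE_iff_measurable[of "{x. 0 < f x}"]) auto
  moreover have "emeasure \<mu> {x. 0 < f x} > 0"
    using assms(3,4) op support_\<mu> unfolding msupport_def by blast
  ultimately show False by simp
qed

section \<open>Localizing matrices as a test on squares\<close>

lemma localizing_matrix_eq_integ:
  "localizing_matrix p (moments K \<mu>) \<alpha> \<beta> = integ (\<lambda>x. peval p x * (monomial \<alpha> x * monomial \<beta> x))"
proof -
  have "peval p x * (monomial \<alpha> x * monomial \<beta> x)
      = (\<Sum>\<gamma>\<in>Poly_Mapping.keys p. Poly_Mapping.lookup p \<gamma> * monomial (\<alpha> + \<beta> + \<gamma>) x)" for x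
    by (simp add: peval_def monomial_add sum_distrib_right sum_distrib_left mult_ac)
  then have "integ (\<lambda>x. peval p x * (monomial \<alpha> x * monomial \<beta> x))
      = integ (\<lambda>x. \<Sum>\<gamma>\<in>Poly_Mapping.keys p. Poly_Mapping.lookup p \<gamma> * monomial (\<alpha> + \<beta> + \<gamma>) x)"
    by presburger
  also have "\<dots> = (\<Sum>\<gamma>\<in>Poly_Mapping.keys p.
      integ (\<lambda>x. Poly_Mapping.lookup p \<gamma> * monomial (\<alpha> + \<beta> + \<gamma>) x))"
    by (intro integ_sum continuous_intros)
  also have "\<dots> = localizing_matrix p (moments K \<mu>) \<alpha> \<beta>"
    by (simp add: integ_cmult localizing_matrix_def moments_def integ_def)
  finally show ?thesis by simp
qed

lemma integ_gram:
  assumes "continuous_on UNIV f"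
  shows "integ (\<lambda>x. f x * (\<Sum>\<alpha>\<in>A. \<Sum>\<beta>\<in>A. Q \<alpha> \<beta> * (monomial \<alpha> x * monomial \<beta> x)))
    = (\<Sum>\<alpha>\<in>A. \<Sum>\<beta>\<in>A. Q \<alpha> \<beta> * integ (\<lambda>x. f x * (monomial \<alpha> x * monomial \<beta> x)))"
proof -
  have "integ (\<lambda>x. f x * (\<Sum>\<alpha>\<in>A. \<Sum>\<beta>\<in>A. Q \<alpha> \<beta> * (monomial \<alpha> x * monomial \<beta> x)))
      = integ (\<lambda>x. \<Sum>\<alpha>\<in>A. \<Sum>\<beta>\<in>A. Q \<alpha> \<beta> * (f x * (monomial \<alpha> x * monomial \<beta> x)))"
    by (simp add: sum_distrib_left mult_ac)
  also have "\<dots> = (\<Sum>\<alpha>\<in>A. integ (\<lambda>x. \<Sum>\<beta>\<in>A. Q \<alpha> \<beta> * (f x * (monomial \<alpha> x * monomial \<beta> x))))"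
    by (intro integ_sum continuous_intros assms)
  also have "\<dots> = (\<Sum>\<alpha>\<in>A. \<Sum>\<beta>\<in>A. integ (\<lambda>x. Q \<alpha> \<beta> * (f x * (monomial \<alpha> x * monomial \<beta> x))))"
    by (intro sum.cong refl integ_sum continuous_intros assms)
  finally show ?thesis by (simp only: integ_cmult)
qed

text \<open>A vector on the index set is the coefficient vector of a polynomial \<open>q\<close>,
  and the quadratic form at it is the integral of \<open>p * q\<^sup>2\<close>. Later arguments use
  only this form of the constraint.\<close>

lemma psd_localizing_matrix_iff:
  "psd_on {\<alpha>. mdeg \<alpha> \<le> k} (localizing_matrix p (moments K \<mu>))
    \<longleftrightarrow> (\<forall>q\<in>polys_upto k. 0 \<le> integ (\<lambda>x. peval p x * (peval q x)\<^sup>2))"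
proof -
  let ?I = "{\<alpha> :: 'n midx. mdeg \<alpha> \<le> k}"
  have quad: "(\<Sum>\<alpha>\<in>?I. \<Sum>\<beta>\<in>?I. v \<alpha> * localizing_matrix p (moments K \<mu>) \<alpha> \<beta> * v \<beta>)
      = integ (\<lambda>x. peval p x * (\<Sum>\<alpha>\<in>?I. v \<alpha> * monomial \<alpha> x)\<^sup>2)" for v
  proof -
    have "integ (\<lambda>x. peval p x * (\<Sum>\<alpha>\<in>?I. v \<alpha> * monomial \<alpha> x)\<^sup>2)
        = integ (\<lambda>x. peval p x * (\<Sum>\<alpha>\<in>?I. \<Sum>\<beta>\<in>?I. (v \<alpha> * v \<beta>) * (monomial \<alpha> x * monomial \<beta> x)))"
      by (simp only: power2_eq_square sum_product mult_ac)
    then show ?thesis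
      unfolding localizing_matrix_eq_integ integ_gram[OF continuous_on_peval]
      by (simp add: mult_ac)
  qed
  have "psd_on ?I (localizing_matrix p (moments K \<mu>))
      \<longleftrightarrow> (\<forall>v. 0 \<le> integ (\<lambda>x. peval p x * (\<Sum>\<alpha>\<in>?I. v \<alpha> * monomial \<alpha> x)\<^sup>2))"
    unfolding psd_on_def quad by (simp add: localizing_matrix_def add.commute)
  also have "\<dots> \<longleftrightarrow> (\<forall>q\<in>polys_upto k. 0 \<le> integ (\<lambda>x. peval p x * (peval q x)\<^sup>2))"
  proof (intro iffI ballI allI)
    fix v
    assume "\<forall>q\<in>polys_upto k. 0 \<le> integ (\<lambda>x. peval p x * (peval q x)\<^sup>2)"
    from bspec[OF this poly_of_in_polys_upto]
    show "0 \<le> integ (\<lambda>x. peval p x * (\<Sum>\<alpha>\<in>?I. v \<alpha> * monomial \<alpha> x)\<^sup>2)"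
      unfolding peval_poly_of .
  qed (simp add: peval_poly_upto)
  finally show ?thesis .
qed

lemma feasible_relax_iff:
  "g \<in> feasible_relax d K \<mu> k \<longleftrightarrow> g \<in> compact_forms (2 * d) \<and>
    (\<forall>q\<in>polys_upto k. 0 \<le> integ (\<lambda>x. (1 - peval g x) * (peval q x)\<^sup>2))"
  by (simp add: feasible_relax_def psd_localizing_matrix_iff peval_diff)

lemma feasible_relax_sos:
  assumes "g \<in> feasible_relax d K \<mu> k" "\<sigma> \<in> sos k"
  shows "0 \<le> integ (\<lambda>x. (1 - peval g x) * peval \<sigma> x)"
proof -
  obtain qs where qs: "set qs \<subseteq> polys_upto k" "\<sigma> = (\<Sum>q\<leftarrow>qs. q ^ 2)"
    using assms(2) by (auto simp: sos_def)
  have "integ (\<lambda>x. (1 - peval g x) * peval \<sigma> x)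
      = integ (\<lambda>x. \<Sum>q\<leftarrow>qs. (1 - peval g x) * (peval q x)\<^sup>2)"
    by (simp add: qs(2) peval_sum_list peval_power o_def sum_list_const_mult)
  also have "\<dots> = (\<Sum>q\<leftarrow>qs. integ (\<lambda>x. (1 - peval g x) * (peval q x)\<^sup>2))"
    by (intro integ_sum_list continuous_intros)
  also have "\<dots> \<ge> 0"
    using assms(1) qs(1) by (intro sum_list_nonneg) (auto simp: feasible_relax_iff)
  finally show ?thesis .
qed

lemma feasible_relax_antimono: "j \<le> k \<Longrightarrow> feasible_relax d K \<mu> k \<subseteq> feasible_relax d K \<mu> j"
  by (force simp: feasible_relax_iff polys_upto_def)

lemma feasible_subset_relax: "feasible d K \<subseteq> feasible_relax d K \<mu> k"
  by (auto simp: feasible_relax_iff feasible_def nonneg_polys_def peval_diff intro!: integ_nonneg)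

text \<open>The constant is the minimum of the integral of \<open>q\<^sup>2\<close> over coefficient
  vectors of norm 1. It is positive because a nonzero polynomial is nonzero somewhere in the
  interior of \<open>K\<close>, hence at a point of the support.\<close>

lemma square_coercive:
  obtains e where "e > 0"
    "\<And>q \<alpha>. q \<in> polys_upto k \<Longrightarrow> e * (Poly_Mapping.lookup q \<alpha>)\<^sup>2 \<le> integ (\<lambda>x. (peval q x)\<^sup>2)"
proof -
  let ?I = "{\<alpha> :: 'n midx. mdeg \<alpha> \<le> k}"
  have fin: "finite ?I" by (rule finite_mdeg_le)
  \<comment> \<open>The box also bounds the coordinates outside \<open>?I\<close>, which the sphere
    equation does not see, so that \<open>S\<close> is compact.\<close>
  define S where "S = PiE UNIV (\<lambda>_. {-1..1::real}) \<inter> {v :: 'n midx \<Rightarrow> real. (\<Sum>\<alpha>\<in>?I. (v \<alpha>)\<^sup>2) = 1}"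
  define f where "f v = integ (\<lambda>x. (peval (poly_of ?I v) x)\<^sup>2)" for v
  have f_eq: "f v = (\<Sum>\<alpha>\<in>?I. \<Sum>\<beta>\<in>?I. (v \<alpha> * v \<beta>) * integ (\<lambda>x. 1 * (monomial \<alpha> x * monomial \<beta> x)))" for v
    unfolding f_def peval_poly_of integ_gram[OF continuous_on_const, symmetric]
    by (simp add: power2_eq_square sum_product mult_ac)
  have "compact S"
    unfolding S_def
    by (intro compact_Int_closed compact_PiE_UNIV closed_Collect_eq continuous_intros) simp
  moreover have "S \<noteq> {}"
  proof -
    have "(\<Sum>\<alpha>\<in>?I. (if \<alpha> = 0 then 1 else 0)\<^sup>2) = (\<Sum>\<alpha>\<in>?I. if \<alpha> = 0 then 1 else (0 :: real))"
      by (intro sum.cong) auto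
    then have "(\<lambda>\<alpha>. if \<alpha> = 0 then 1 else 0) \<in> S"
      using fin by (auto simp: S_def)
    then show ?thesis by blast
  qed
  moreover have "continuous_on S f"
    unfolding f_eq by (intro continuous_intros)
  ultimately obtain v where v: "v \<in> S" "\<And>w. w \<in> S \<Longrightarrow> f v \<le> f w"
    using continuous_attains_inf[of S f] by blast
  have "poly_of ?I v \<noteq> 0"
  proof
    assume 0: "poly_of ?I v = 0"
    have "v \<alpha> = 0" if "\<alpha> \<in> ?I" for \<alpha>
      using arg_cong[OF 0, of "\<lambda>p. Poly_Mapping.lookup p \<alpha>"] that by (simp add: lookup_poly_of fin)
    then show False using v(1) by (simp add: S_def)
  qed
  then obtain a where a: "a \<in> interior K" "peval (poly_of ?I v) a \<noteq> 0"
    using peval_zero_on_open[of "interior K"] interior_K by blast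
  have fv: "f v > 0"
    unfolding f_def using a interior_subset
    by (intro integ_pos[of _ a] continuous_intros) auto
  show ?thesis
  proof (rule that[OF fv])
    fix q :: "'n rpoly" and \<alpha> assume q: "q \<in> polys_upto k"
    define N where "N = (\<Sum>\<alpha>\<in>?I. (Poly_Mapping.lookup q \<alpha>)\<^sup>2)"
    have le: "(Poly_Mapping.lookup q \<beta>)\<^sup>2 \<le> N" for \<beta>
    proof (cases "\<beta> \<in> ?I")
      case True
      then show ?thesis unfolding N_def by (intro member_le_sum fin) auto
    next
      case False
      then have "Poly_Mapping.lookup q \<beta> = 0" using q by (auto simp: polys_upto_def in_keys_iff)
      then show ?thesis by (simp add: N_def sum_nonneg)
    qed
    show "f v * (Poly_Mapping.lookup q \<alpha>)\<^sup>2 \<le> integ (\<lambda>x. (peval q x)\<^sup>2)"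
    proof (cases "N = 0")
      case True
      then have "(Poly_Mapping.lookup q \<alpha>)\<^sup>2 = 0" using le[of \<alpha>] by simp
      then show ?thesis by (simp add: integ_nonneg)
    next
      case False
      then have N: "N > 0" using le[of 0] zero_le_power2 order_trans less_le by metis
      define w where "w \<beta> = Poly_Mapping.lookup q \<beta> / sqrt N" for \<beta>
      have w2: "(w \<beta>)\<^sup>2 = (Poly_Mapping.lookup q \<beta>)\<^sup>2 / N" for \<beta>
        using N by (simp add: w_def power_divide)
      have "\<bar>w \<beta>\<bar> \<le> 1" for \<beta>
        using w2[of \<beta>] le[of \<beta>] N by (simp add: abs_square_le_1[symmetric])
      moreover have "(\<Sum>\<alpha>\<in>?I. (w \<alpha>)\<^sup>2) = 1"
        using N by (simp add: w2 N_def sum_divide_distrib[symmetric])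
      ultimately have "w \<in> S" by (auto simp: S_def abs_le_iff minus_le_iff)
      then have "f v \<le> f w" by (rule v(2))
      also have "f w = integ (\<lambda>x. 1 / N * (peval q x)\<^sup>2)"
      proof -
        have "peval (poly_of ?I w) x = peval q x / sqrt N" for x
          by (simp add: peval_poly_of peval_poly_upto[OF q] w_def sum_divide_distrib)
        then show ?thesis using N by (simp add: f_def power_divide)
      qed
      also have "\<dots> = integ (\<lambda>x. (peval q x)\<^sup>2) / N" unfolding integ_cmult by simp
      finally have "f v * N \<le> integ (\<lambda>x. (peval q x)\<^sup>2)" using N by (simp add: field_simps)
      moreover have "f v * (Poly_Mapping.lookup q \<alpha>)\<^sup>2 \<le> f v * N"
        using le fv by (intro mult_left_mono) auto
      ultimately show ?thesis by linarith
    qed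
  qed
qed

lemma sos_of_gram:
  assumes "psd_on {\<alpha> :: 'n midx. mdeg \<alpha> \<le> k} Q"
  obtains \<sigma> where "\<sigma> \<in> sos k" "\<And>x. peval \<sigma> x =
    (\<Sum>\<alpha> | mdeg \<alpha> \<le> k. \<Sum>\<beta> | mdeg \<beta> \<le> k. Q \<alpha> \<beta> * (monomial \<alpha> x * monomial \<beta> x))"
proof -
  let ?I = "{\<alpha> :: 'n midx. mdeg \<alpha> \<le> k}"
  obtain vs where vs: "\<And>\<alpha> \<beta>. \<alpha> \<in> ?I \<Longrightarrow> \<beta> \<in> ?I \<Longrightarrow> Q \<alpha> \<beta> = (\<Sum>v\<leftarrow>vs. v \<alpha> * v \<beta>)"
    using psd_on_sum_of_squares[OF finite_mdeg_le assms] by blast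
  let ?\<sigma> = "\<Sum>q\<leftarrow>map (poly_of ?I) vs. q ^ 2"
  show ?thesis
  proof
    have "set (map (poly_of ?I) vs) \<subseteq> polys_upto k" using poly_of_in_polys_upto by auto
    then show "?\<sigma> \<in> sos k" unfolding sos_def by blast
    fix x
    have "peval ?\<sigma> x = (\<Sum>v\<leftarrow>vs. (\<Sum>\<alpha>\<in>?I. v \<alpha> * monomial \<alpha> x)\<^sup>2)"
      by (simp add: peval_sum_list peval_power peval_poly_of o_def)
    also have "\<dots> = (\<Sum>\<alpha>\<in>?I. \<Sum>\<beta>\<in>?I. (\<Sum>v\<leftarrow>vs. v \<alpha> * v \<beta>) * (monomial \<alpha> x * monomial \<beta> x))"
      by (rule quad_form_sum_list[where f = "\<lambda>v. v", symmetric])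
    also have "\<dots> = (\<Sum>\<alpha>\<in>?I. \<Sum>\<beta>\<in>?I. Q \<alpha> \<beta> * (monomial \<alpha> x * monomial \<beta> x))"
      using vs by (intro sum.cong refl) simp
    finally show "peval ?\<sigma> x = (\<Sum>\<alpha>\<in>?I. \<Sum>\<beta>\<in>?I. Q \<alpha> \<beta> * (monomial \<alpha> x * monomial \<beta> x))" .
  qed
qed

text \<open>However many squares \<sigma> has, all its information sits in one matrix. Each square
  contributes to an entry at most the mean of two squared coefficients, which \<open>e\<close>
  compares with its integral.\<close>

lemma gram_of_sos:
  assumes "\<sigma> \<in> sos k" "e > 0"
    and e: "\<And>q \<alpha>. q \<in> polys_upto k \<Longrightarrow> e * (Poly_Mapping.lookup q \<alpha>)\<^sup>2 \<le> integ (\<lambda>x. (peval q x)\<^sup>2)"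
  obtains Q where "psd_on {\<alpha> :: 'n midx. mdeg \<alpha> \<le> k} Q"
    "\<And>\<alpha> \<beta>. \<bar>Q \<alpha> \<beta>\<bar> \<le> integ (peval \<sigma>) / e"
    "\<And>x. peval \<sigma> x =
      (\<Sum>\<alpha> | mdeg \<alpha> \<le> k. \<Sum>\<beta> | mdeg \<beta> \<le> k. Q \<alpha> \<beta> * (monomial \<alpha> x * monomial \<beta> x))"
proof -
  let ?I = "{\<alpha> :: 'n midx. mdeg \<alpha> \<le> k}" and ?l = Poly_Mapping.lookup
  obtain qs where qs: "set qs \<subseteq> polys_upto k" "\<sigma> = (\<Sum>q\<leftarrow>qs. q ^ 2)"
    using assms(1) by (auto simp: sos_def)
  define Q where "Q \<alpha> \<beta> = (\<Sum>q\<leftarrow>qs. ?l q \<alpha> * ?l q \<beta>)" for \<alpha> \<beta>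
  have peval_\<sigma>: "peval \<sigma> x = (\<Sum>q\<leftarrow>qs. (peval q x)\<^sup>2)" for x
    by (simp add: qs(2) peval_sum_list peval_power o_def)
  show ?thesis
  proof
    show "psd_on ?I Q"
      unfolding psd_on_def
    proof (intro conjI ballI allI)
      show "Q \<alpha> \<beta> = Q \<beta> \<alpha>" for \<alpha> \<beta> by (simp add: Q_def mult.commute)
      fix v
      have "(\<Sum>\<alpha>\<in>?I. \<Sum>\<beta>\<in>?I. v \<alpha> * Q \<alpha> \<beta> * v \<beta>) = (\<Sum>q\<leftarrow>qs. (\<Sum>\<alpha>\<in>?I. v \<alpha> * ?l q \<alpha>)\<^sup>2)"
        using quad_form_sum_list[where f = ?l and m = v, symmetric]
        by (simp add: Q_def mult_ac)
      also have "\<dots> \<ge> 0" by (intro sum_list_nonneg) auto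
      finally show "0 \<le> (\<Sum>\<alpha>\<in>?I. \<Sum>\<beta>\<in>?I. v \<alpha> * Q \<alpha> \<beta> * v \<beta>)" .
    qed
    show "\<bar>Q \<alpha> \<beta>\<bar> \<le> integ (peval \<sigma>) / e" for \<alpha> \<beta>
    proof -
      have "e * \<bar>Q \<alpha> \<beta>\<bar> \<le> (\<Sum>q\<leftarrow>qs. integ (\<lambda>x. (peval q x)\<^sup>2))"
        unfolding Q_def using qs(1)
      proof (induction qs)
        case (Cons q qs)
        have "(\<bar>?l q \<alpha>\<bar> - \<bar>?l q \<beta>\<bar>)\<^sup>2 \<ge> 0" by simp
        then have "2 * \<bar>?l q \<alpha> * ?l q \<beta>\<bar> \<le> (?l q \<alpha>)\<^sup>2 + (?l q \<beta>)\<^sup>2"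
          by (simp add: power2_diff abs_mult)
        then have "e * (2 * \<bar>?l q \<alpha> * ?l q \<beta>\<bar>) \<le> e * ((?l q \<alpha>)\<^sup>2 + (?l q \<beta>)\<^sup>2)"
          using assms(2) by (intro mult_left_mono) auto
        also have "\<dots> \<le> 2 * integ (\<lambda>x. (peval q x)\<^sup>2)"
          using e[of q \<alpha>] e[of q \<beta>] Cons.prems by (simp add: distrib_left)
        finally have "e * \<bar>?l q \<alpha> * ?l q \<beta>\<bar> \<le> integ (\<lambda>x. (peval q x)\<^sup>2)" by simp
        moreover have "e * \<bar>\<Sum>q\<leftarrow>q # qs. ?l q \<alpha> * ?l q \<beta>\<bar>
            \<le> e * (\<bar>?l q \<alpha> * ?l q \<beta>\<bar> + \<bar>\<Sum>q\<leftarrow>qs. ?l q \<alpha> * ?l q \<beta>\<bar>)"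
          using assms(2) by (intro mult_left_mono) auto
        ultimately show ?case using Cons by (simp add: distrib_left)
      qed simp
      also have "\<dots> = integ (\<lambda>x. \<Sum>q\<leftarrow>qs. (peval q x)\<^sup>2)"
        by (intro integ_sum_list[symmetric] continuous_intros)
      finally show ?thesis
        using assms(2) by (simp add: peval_\<sigma>[abs_def] field_simps)
    qed
    fix x
    have "(\<Sum>\<alpha>\<in>?I. \<Sum>\<beta>\<in>?I. Q \<alpha> \<beta> * (monomial \<alpha> x * monomial \<beta> x))
        = (\<Sum>q\<leftarrow>qs. (\<Sum>\<alpha>\<in>?I. ?l q \<alpha> * monomial \<alpha> x)\<^sup>2)"
      unfolding Q_def by (rule quad_form_sum_list)
    also have "\<dots> = peval \<sigma> x"
      unfolding peval_\<sigma> using qs(1) by (intro arg_cong[where f = sum_list] map_cong refl)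
        (auto simp: peval_poly_upto)
    finally show "peval \<sigma> x = (\<Sum>\<alpha>\<in>?I. \<Sum>\<beta>\<in>?I. Q \<alpha> \<beta> * (monomial \<alpha> x * monomial \<beta> x))" by simp
  qed
qed

text \<open>A Farkas lemma for the cone of vectors \<open>(integ (\<phi> j * \<sigma>))\<close> with \<open>\<sigma>\<close> a sum of squares.
  The cone is closed because the total mass of \<open>\<sigma>\<close>, which bounds its Gram matrix, is a linear
  function of that vector.\<close>

lemma sos_moment_alternative:
  fixes \<phi> :: "'j \<Rightarrow> real ^ 'n \<Rightarrow> real"
  assumes "finite J" and cont: "\<And>j. continuous_on UNIV (\<phi> j)"
    and one: "\<And>x. (\<Sum>j\<in>J. w j * \<phi> j x) = 1"
  obtains \<sigma> where "\<sigma> \<in> sos k" "\<And>j. j \<in> J \<Longrightarrow> integ (\<lambda>x. \<phi> j x * peval \<sigma> x) = y j"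
  | h where "(\<Sum>j\<in>J. h j * y j) > 0"
    "\<And>\<sigma>. \<sigma> \<in> sos k \<Longrightarrow> (\<Sum>j\<in>J. h j * integ (\<lambda>x. \<phi> j x * peval \<sigma> x)) \<le> 0"
proof -
  let ?I = "{\<alpha> :: 'n midx. mdeg \<alpha> \<le> k}"
  obtain e where e: "e > 0"
    "\<And>q \<alpha>. q \<in> polys_upto k \<Longrightarrow> e * (Poly_Mapping.lookup q \<alpha>)\<^sup>2 \<le> integ (\<lambda>x. (peval q x)\<^sup>2)"
    using square_coercive by blast
  \<comment> \<open>Gram matrices are functions of a pair, so that they are points of one product
    space.\<close>
  define val where "val Q j = (\<Sum>\<alpha>\<in>?I. \<Sum>\<beta>\<in>?I.
    Q (\<alpha>, \<beta>) * integ (\<lambda>x. \<phi> j x * (monomial \<alpha> x * monomial \<beta> x)))" for Q :: "'n midx \<times> 'n midx \<Rightarrow> real" and j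
  have val: "val Q j = integ (\<lambda>x. \<phi> j x * peval \<sigma> x)"
    if "\<And>x. peval \<sigma> x = (\<Sum>\<alpha>\<in>?I. \<Sum>\<beta>\<in>?I. Q (\<alpha>, \<beta>) * (monomial \<alpha> x * monomial \<beta> x))" for Q j \<sigma>
    unfolding that val_def by (rule integ_gram[OF cont, symmetric])
  define F where "F b = (\<Sum>j\<in>J. (b j - y j)\<^sup>2)" for b
  define psd where "psd Q \<longleftrightarrow> psd_on ?I (\<lambda>\<alpha> \<beta>. Q (\<alpha>, \<beta>))" for Q :: "'n midx \<times> 'n midx \<Rightarrow> real"
  define A where "A = {val Q | Q. psd Q}"
  \<comment> \<open>If \<open>F b \<le> F 0\<close>, then each \<open>b j\<close> differs from
    \<open>y j\<close> by at most \<open>F 0 + 1\<close>, a bound for the square root of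
    \<open>F 0\<close>. Hence the mass, which is the sum of the \<open>w j * b j\<close>, is at most
    \<open>R * e\<close>.\<close>
  define R where "R = (\<Sum>j\<in>J. \<bar>w j\<bar> * (\<bar>y j\<bar> + F (\<lambda>_. 0) + 1)) / e"
  have F0: "F (\<lambda>_. 0) \<ge> 0" by (simp add: F_def sum_nonneg)
  define P where "P = PiE UNIV (\<lambda>_. {-R..R}) \<inter> {Q. psd Q}"
  have "closed {Q. psd Q}"
    unfolding psd_def psd_on_def Ball_def
    by (intro closed_Collect_conj closed_Collect_all closed_Collect_imp open_Collect_const
        closed_Collect_eq closed_Collect_le continuous_intros)
  then have "compact P"
    unfolding P_def by (intro compact_Int_closed compact_PiE_UNIV) auto
  have psd0: "psd (\<lambda>_. 0)" by (simp add: psd_def psd_on_def)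
  have "R \<ge> 0" using e(1) F0 unfolding R_def by (intro divide_nonneg_pos sum_nonneg) auto
  then have P0: "(\<lambda>_. 0) \<in> P" using psd0 by (auto simp: P_def)
  have "continuous_on P (\<lambda>Q. F (val Q))"
    unfolding F_def val_def by (intro continuous_intros)
  with \<open>compact P\<close> P0 obtain Q0 where Q0: "Q0 \<in> P" "\<And>Q. Q \<in> P \<Longrightarrow> F (val Q0) \<le> F (val Q)"
    using continuous_attains_inf[of P "\<lambda>Q. F (val Q)"] by blast
  \<comment> \<open>Passing from \<open>Q\<close> to its polynomial and back to a Gram matrix
    preserves \<open>val\<close>, and the new entries are bounded by the mass divided by
    \<open>e\<close>.\<close>
  have small: "\<exists>Q'\<in>P. val Q' = val Q" if Q: "psd Q" "F (val Q) \<le> F (\<lambda>_. 0)" for Q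
  proof -
    obtain \<sigma> where \<sigma>: "\<sigma> \<in> sos k"
      "\<And>x. peval \<sigma> x = (\<Sum>\<alpha>\<in>?I. \<Sum>\<beta>\<in>?I. Q (\<alpha>, \<beta>) * (monomial \<alpha> x * monomial \<beta> x))"
      using sos_of_gram[OF Q(1)[unfolded psd_def]] by blast
    obtain Q' where Q': "psd_on ?I Q'" "\<And>\<alpha> \<beta>. \<bar>Q' \<alpha> \<beta>\<bar> \<le> integ (peval \<sigma>) / e"
      "\<And>x. peval \<sigma> x = (\<Sum>\<alpha>\<in>?I. \<Sum>\<beta>\<in>?I. Q' \<alpha> \<beta> * (monomial \<alpha> x * monomial \<beta> x))"
      using gram_of_sos[OF \<sigma>(1) e] by blast
    have "integ (peval \<sigma>) = integ (\<lambda>x. \<Sum>j\<in>J. w j * (\<phi> j x * peval \<sigma> x))"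
    proof -
      have "peval \<sigma> x = (\<Sum>j\<in>J. w j * (\<phi> j x * peval \<sigma> x))" for x
        using one[of x] by (simp add: sum_distrib_right[symmetric] mult.assoc[symmetric])
      then show ?thesis by presburger
    qed
    also have "\<dots> = (\<Sum>j\<in>J. integ (\<lambda>x. w j * (\<phi> j x * peval \<sigma> x)))"
      by (intro integ_sum continuous_intros cont)
    also have "\<dots> = (\<Sum>j\<in>J. w j * val Q j)"
      by (simp only: integ_cmult val[OF \<sigma>(2)])
    also have "\<dots> \<le> (\<Sum>j\<in>J. \<bar>w j\<bar> * (\<bar>y j\<bar> + F (\<lambda>_. 0) + 1))"
    proof (rule sum_mono)
      fix j assume "j \<in> J"
      then have "(val Q j - y j)\<^sup>2 \<le> F (val Q)"
        unfolding F_def using assms(1) by (intro member_le_sum) auto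
      also have "\<dots> \<le> (F (\<lambda>_. 0) + 1) * 1" using Q(2) by simp
      also have "\<dots> \<le> (F (\<lambda>_. 0) + 1)\<^sup>2"
        unfolding power2_eq_square using F0 by (intro mult_left_mono) auto
      finally have "(val Q j - y j)\<^sup>2 \<le> (F (\<lambda>_. 0) + 1)\<^sup>2" .
      then have "\<bar>val Q j - y j\<bar> \<le> F (\<lambda>_. 0) + 1"
        using F0 by (simp add: abs_le_square_iff[symmetric])
      then have "\<bar>val Q j\<bar> \<le> \<bar>y j\<bar> + F (\<lambda>_. 0) + 1" by linarith
      then have "\<bar>w j\<bar> * \<bar>val Q j\<bar> \<le> \<bar>w j\<bar> * (\<bar>y j\<bar> + F (\<lambda>_. 0) + 1)"
        by (intro mult_left_mono) auto
      then show "w j * val Q j \<le> \<bar>w j\<bar> * (\<bar>y j\<bar> + F (\<lambda>_. 0) + 1)"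
        using abs_ge_self[of "w j * val Q j"] by (simp add: abs_mult)
    qed
    finally have "integ (peval \<sigma>) / e \<le> R" unfolding R_def using e(1) by (simp add: divide_right_mono)
    then have "\<bar>Q' \<alpha> \<beta>\<bar> \<le> R" for \<alpha> \<beta> using Q'(2)[of \<alpha> \<beta>] by linarith
    then have "case_prod Q' \<in> P"
      using Q'(1) by (auto simp: P_def psd_def abs_le_iff minus_le_iff)
    moreover have "val (case_prod Q') = val Q"
      using val[OF \<sigma>(2)] val[of \<sigma> "case_prod Q'"] Q'(3) by (intro ext) simp
    ultimately show ?thesis by blast
  qed
  \<comment> \<open>Points at distance beyond that of 0 lose against the zero matrix in
    \<open>P\<close>; all others are covered by \<open>small\<close>.\<close>
  have near: "F (val Q0) \<le> F b" if b: "b \<in> A" for b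
  proof -
    obtain Q where Q: "b = val Q" "psd Q" using b unfolding A_def by blast
    have "val (\<lambda>_. 0) = (\<lambda>_. 0)" by (simp add: val_def fun_eq_iff)
    then have "F (val Q0) \<le> F (\<lambda>_. 0)" using Q0(2)[OF P0] by simp
    then show ?thesis using small[OF Q(2)] Q0(2) Q(1) by force
  qed
  have A_I: "val Q \<in> A" if "psd Q" for Q using that unfolding A_def by blast
  have A_add: "(\<lambda>j. b j + c j) \<in> A" if bc: "b \<in> A" "c \<in> A" for b c
  proof -
    obtain Q Q' where "b = val Q" "psd Q" "c = val Q'" "psd Q'" using bc unfolding A_def by blast
    moreover from this have "psd (\<lambda>i. Q i + Q' i)"
      by (auto simp: psd_def psd_on_def algebra_simps sum.distrib)
    moreover have "val (\<lambda>i. Q i + Q' i) = (\<lambda>j. val Q j + val Q' j)"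
      by (simp add: val_def fun_eq_iff algebra_simps sum.distrib)
    ultimately show ?thesis using A_I[of "\<lambda>i. Q i + Q' i"] by simp
  qed
  have A_scale: "(\<lambda>j. t * b j) \<in> A" if bt: "b \<in> A" "t \<ge> 0" for b t
  proof -
    obtain Q where "b = val Q" "psd Q" using bt unfolding A_def by blast
    moreover from this have "psd (\<lambda>i. t * Q i)"
    proof -
      have "(\<Sum>\<alpha>\<in>?I. \<Sum>\<beta>\<in>?I. v \<alpha> * (t * Q (\<alpha>, \<beta>)) * v \<beta>)
          = t * (\<Sum>\<alpha>\<in>?I. \<Sum>\<beta>\<in>?I. v \<alpha> * Q (\<alpha>, \<beta>) * v \<beta>)" for v
        by (simp add: sum_distrib_left mult_ac)
      then show ?thesis using \<open>psd Q\<close> bt(2) by (auto simp: psd_def psd_on_def)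
    qed
    moreover have "val (\<lambda>i. t * Q i) = (\<lambda>j. t * val Q j)"
      by (simp add: val_def fun_eq_iff sum_distrib_left mult_ac)
    ultimately show ?thesis using A_I[of "\<lambda>i. t * Q i"] by simp
  qed
  have Q0A: "val Q0 \<in> A" using Q0(1) by (intro A_I) (simp add: P_def)
  \<comment> \<open>The residual at the nearest point: if it vanishes on \<open>J\<close>, then
    \<open>Q0\<close> solves the moment equations, otherwise it is the normal of a separating
    hyperplane.\<close>
  let ?h = "\<lambda>j. y j - val Q0 j"
  have sep1: "(\<Sum>j\<in>J. ?h j * b j) \<le> 0" if "b \<in> A" for b
    by (rule nearest_point_of_cone_separates(1)[OF Q0A _ _ _ that])
       (use near A_add A_scale in \<open>simp_all add: F_def\<close>)
  have sep2: "(\<Sum>j\<in>J. (?h j)\<^sup>2) \<le> (\<Sum>j\<in>J. ?h j * y j)"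
    by (rule nearest_point_of_cone_separates(2)[OF Q0A])
       (use near A_add A_scale in \<open>simp_all add: F_def\<close>)
  show ?thesis
  proof (cases "\<forall>j\<in>J. ?h j = 0")
    case True
    obtain \<sigma> where \<sigma>: "\<sigma> \<in> sos k"
      "\<And>x. peval \<sigma> x = (\<Sum>\<alpha>\<in>?I. \<Sum>\<beta>\<in>?I. Q0 (\<alpha>, \<beta>) * (monomial \<alpha> x * monomial \<beta> x))"
      using sos_of_gram[of k "\<lambda>\<alpha> \<beta>. Q0 (\<alpha>, \<beta>)"] Q0(1) by (auto simp: P_def psd_def)
    have "integ (\<lambda>x. \<phi> j x * peval \<sigma> x) = y j" if "j \<in> J" for j
      using val[OF \<sigma>(2), of j] True that by simp
    with \<sigma>(1) show ?thesis by (rule that(1))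
  next
    case False
    then obtain i where "i \<in> J" "?h i \<noteq> 0" by blast
    then have "(\<Sum>j\<in>J. (?h j)\<^sup>2) > 0"
      using assms(1) by (intro sum_pos2[of J i]) auto
    then have "(\<Sum>j\<in>J. ?h j * y j) > 0" using sep2 by linarith
    then show ?thesis
    proof (rule that(2))
      fix \<sigma> :: "'n rpoly" assume "\<sigma> \<in> sos k"
      then obtain Q where Q: "psd_on ?I Q"
        "\<And>x. peval \<sigma> x = (\<Sum>\<alpha>\<in>?I. \<Sum>\<beta>\<in>?I. Q \<alpha> \<beta> * (monomial \<alpha> x * monomial \<beta> x))"
        using gram_of_sos[OF _ e] by blast
      have "val (case_prod Q) \<in> A" using Q(1) by (intro A_I) (simp add: psd_def)
      from sep1[OF this] show "(\<Sum>j\<in>J. ?h j * integ (\<lambda>x. \<phi> j x * peval \<sigma> x)) \<le> 0"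
        using val[of \<sigma> "case_prod Q"] Q(2) by simp
    qed
  qed
qed

end

section \<open>Optimality and convergence\<close>

text \<open>Stated with integrability in place of membership in the cone, because it is applied to a
  limit form that may have left the cone.\<close>

lemma objective_convex_combination:
  assumes "0 \<le> t" "t \<le> 1"
    and "integrable lborel (\<lambda>x. exp (- peval f x))" "integrable lborel (\<lambda>x. exp (- peval g x))"
    and h: "\<And>x. peval h x = (1 - t) * peval f x + t * peval g x"
  shows "objective h \<le> (1 - t) * objective f + t * objective g"
proof -
  have "exp (- peval h x) \<le> (1 - t) * exp (- peval f x) + t * exp (- peval g x)" for x
    using convex_onD[OF exp_convex, of t "- peval f x" "- peval g x"] assms(1,2)
    by (simp add: h algebra_simps)
  then have "objective h
      \<le> (LINT x|lborel. (1 - t) * exp (- peval f x) + t * exp (- peval g x))"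
    unfolding objective_def using assms(1-4)
    by (intro integral_mono' Bochner_Integration.integrable_add integrable_mult_right) auto
  also have "\<dots> = (1 - t) * objective f + t * objective g"
    using assms(3,4) by (simp add: objective_def)
  finally show ?thesis .
qed

text \<open>The coefficient functions lie in a compact box of a product over countably many
  exponents. Coefficients outside degree \<open>m\<close> are 0 along the sequence, hence in the
  limit, so the limit is again a form.\<close>

lemma bounded_forms_convergent_subsequence:
  fixes g :: "nat \<Rightarrow> 'n::finite rpoly"
  assumes forms: "\<And>k. g k \<in> forms m"
    and bound: "\<And>k \<alpha>. mdeg \<alpha> = m \<Longrightarrow> \<bar>Poly_Mapping.lookup (g k) \<alpha>\<bar> \<le> M"
  obtains f r where "f \<in> forms m" "strict_mono (r :: nat \<Rightarrow> nat)"
    "\<And>\<alpha>. (\<lambda>j. Poly_Mapping.lookup (g (r j)) \<alpha>) \<longlonglongrightarrow> Poly_Mapping.lookup f \<alpha>"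
proof -
  let ?c = "\<lambda>k. Poly_Mapping.lookup (g k)"
  have zero: "?c k \<alpha> = 0" if "mdeg \<alpha> \<noteq> m" for k \<alpha>
    using forms[of k] that by (auto simp: forms_def in_keys_iff)
  have "\<bar>?c k \<alpha>\<bar> \<le> \<bar>M\<bar>" for k \<alpha>
    using bound[of \<alpha> k] zero[of \<alpha> k] by (cases "mdeg \<alpha> = m") auto
  then have "\<forall>k. ?c k \<in> PiE UNIV (\<lambda>_. {-\<bar>M\<bar>..\<bar>M\<bar>})" by (auto simp: abs_le_iff minus_le_iff)
  moreover have "seq_compact (PiE UNIV (\<lambda>_ :: 'n midx. {-\<bar>M\<bar>..\<bar>M\<bar>}))"
    by (intro compact_imp_seq_compact compact_PiE_UNIV) auto
  ultimately obtain l r where r: "strict_mono (r :: nat \<Rightarrow> nat)" and lim: "(?c \<circ> r) \<longlonglongrightarrow> l"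
    using seq_compactE by metis
  have lim': "(\<lambda>j. ?c (r j) \<alpha>) \<longlonglongrightarrow> l \<alpha>" for \<alpha>
    using continuous_on_tendsto_compose[OF continuous_on_coordinate[of UNIV \<alpha>] lim]
    by (simp add: o_def)
  have "Poly_Mapping.lookup (form_of m l) \<alpha> = l \<alpha>" for \<alpha>
    using LIMSEQ_unique[OF lim'[of \<alpha>]] zero[of \<alpha>]
    by (auto simp: lookup_poly_of finite_mdeg_eq)
  with lim' r form_of_in_forms[of m l] show ?thesis by (intro that[of "form_of m l" r]) auto
qed

lemma tendsto_peval_forms:
  assumes "\<And>j. g j \<in> forms m" "f \<in> forms m"
    and "\<And>\<alpha>. (\<lambda>j. Poly_Mapping.lookup (g j) \<alpha>) \<longlonglongrightarrow> Poly_Mapping.lookup f \<alpha>"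
  shows "(\<lambda>j. peval (g j) x) \<longlonglongrightarrow> peval f x"
  unfolding peval_form[OF assms(1)] peval_form[OF assms(2)]
  by (intro tendsto_intros assms(3))

text \<open>A common radius \<open>B\<close> makes every \<open>g j\<close> at least 1 on the sphere
  of radius \<open>B + 1\<close>. This passes to the limit, and homogeneity turns it into
  coercivity.\<close>

lemma form_compact_if_sublevels_bounded:
  fixes f :: "'n::finite rpoly"
  assumes "f \<in> forms m" "m > 0" "\<And>x. 0 \<le> peval f x"
    and lim: "\<And>x. (\<lambda>j. peval (g j) x) \<longlonglongrightarrow> peval f x"
    and bounded: "bounded (\<Union>j. sublevel (g j))"
  shows "f \<in> compact_forms m"
proof -
  obtain B where B: "B > 0" "\<And>j x. peval (g j) x \<le> 1 \<Longrightarrow> norm x \<le> B"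
    using bounded unfolding bounded_pos by (auto simp: sublevel_def)
  show ?thesis
  proof (rule coercive_form_compact[OF assms(1,2)])
    show "(1 / (B + 1)) ^ m > 0" using B(1) by simp
    fix x
    show "(1 / (B + 1)) ^ m * norm x ^ m \<le> peval f x"
    proof (cases "x = 0")
      case True
      then show ?thesis using assms(2,3) by (simp add: zero_power)
    next
      case False
      define y where "y = ((B + 1) / norm x) *\<^sub>R x"
      have "norm y > B" using False B(1) by (simp add: y_def)
      then have "1 \<le> peval (g j) y" for j using B(2)[of j y] by (metis linorder_not_less nle_le)
      then have "1 \<le> peval f y" by (intro LIMSEQ_le_const[OF lim]) auto
      moreover have "peval f x = (norm x / (B + 1)) ^ m * peval f y"
        using peval_form_scaleR[OF assms(1), of "norm x / (B + 1)" y] False B(1)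
        by (simp add: y_def)
      ultimately show ?thesis
        using mult_left_mono[of 1 "peval f y" "(norm x / (B + 1)) ^ m"] B(1)
        by (simp add: power_divide)
    qed
  qed
qed

text \<open>Integrability is part of the conclusion: \<open>f\<close> may vanish on a ray, so
  coercivity cannot supply it, and without it \<open>objective f\<close> would be the default value
  0.\<close>

lemma fatou_objective:
  assumes lim: "\<And>x. (\<lambda>j. peval (g j) x) \<longlonglongrightarrow> peval f x"
    and int: "\<And>j. integrable lborel (\<lambda>x. exp (- peval (g j) x))"
    and le: "\<And>j. objective (g j) \<le> B"
  shows "integrable lborel (\<lambda>x. exp (- peval f x))" "objective f \<le> B"
proof -
  have B: "B \<ge> 0" using le[of 0] by (rule order_trans[rotated]) (simp add: objective_def)
  have "(\<integral>\<^sup>+x. ennreal (exp (- peval f x)) \<partial>lborel)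
      = (\<integral>\<^sup>+x. liminf (\<lambda>j. ennreal (exp (- peval (g j) x))) \<partial>lborel)"
    by (intro nn_integral_cong lim_imp_Liminf[symmetric] tendsto_intros tendsto_ennrealI lim) simp
  also have "\<dots> \<le> liminf (\<lambda>j. \<integral>\<^sup>+x. ennreal (exp (- peval (g j) x)) \<partial>lborel)"
    by (rule nn_integral_liminf) simp
  also have "\<dots> \<le> liminf (\<lambda>j. ennreal B)"
    using int le B
    by (intro Liminf_mono always_eventually) (auto simp: nn_integral_eq_integral objective_def)
  also have "\<dots> = ennreal B" by (simp add: Liminf_const)
  finally have le_B: "(\<integral>\<^sup>+x. ennreal (exp (- peval f x)) \<partial>lborel) \<le> ennreal B" .
  then show int_f: "integrable lborel (\<lambda>x. exp (- peval f x))"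
    by (intro integrableI_nonneg) (auto simp: le_less_trans)
  then show "objective f \<le> B"
    using le_B B by (simp add: nn_integral_eq_integral objective_def)
qed

context moment_setting
begin

section \<open>First-order optimality conditions for the relaxations\<close>

lemma moment_condition_forms:
  assumes "moment_condition d K \<mu> g \<sigma>" "g \<in> compact_forms (2 * d)" "d \<ge> 1" "h \<in> forms (2 * d)"
  shows "(LINT x|lborel. peval h x * exp (- peval g x)) = integ (\<lambda>x. peval h x * peval \<sigma> x)"
proof -
  have int: "integrable lborel (\<lambda>x. monomial \<alpha> x * exp (- peval g x))" if "mdeg \<alpha> = 2 * d" for \<alpha>
    using integrable_form_exp_neg[OF assms(2), of "Poly_Mapping.single \<alpha> 1"] that assms(3)
    by (simp add: peval_single forms_def)
  have "(LINT x|lborel. peval h x * exp (- peval g x))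
      = (LINT x|lborel. (\<Sum>\<alpha> | mdeg \<alpha> = 2 * d.
          Poly_Mapping.lookup h \<alpha> * (monomial \<alpha> x * exp (- peval g x))))"
    by (simp add: peval_form[OF assms(4)] sum_distrib_right mult.assoc)
  also have "\<dots> = (\<Sum>\<alpha> | mdeg \<alpha> = 2 * d.
      Poly_Mapping.lookup h \<alpha> * (LINT x|lborel. monomial \<alpha> x * exp (- peval g x)))"
    using int by simp
  also have "\<dots> = (\<Sum>\<alpha> | mdeg \<alpha> = 2 * d.
      integ (\<lambda>x. Poly_Mapping.lookup h \<alpha> * (monomial \<alpha> x * peval \<sigma> x)))"
    using assms(1) by (simp add: moment_condition_def integ_cmult integ_def)
  also have "\<dots> = integ (\<lambda>x. \<Sum>\<alpha> | mdeg \<alpha> = 2 * d.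
      Poly_Mapping.lookup h \<alpha> * (monomial \<alpha> x * peval \<sigma> x))"
    by (intro integ_sum[symmetric] continuous_intros)
  finally show ?thesis by (simp add: peval_form[OF assms(4)] sum_distrib_right mult.assoc)
qed

lemma integ_one_minus:
  "integ (\<lambda>x. (1 - peval g x) * peval \<sigma> x) = integ (peval \<sigma>) - integ (\<lambda>x. peval g x * peval \<sigma> x)"
  by (subst integ_diff[symmetric]) (auto intro!: continuous_intros simp: left_diff_distrib)

lemma kkt_sufficient:
  assumes "d \<ge> 1" "g \<in> feasible_relax d K \<mu> k" "\<sigma> \<in> sos k"
    and "moment_condition d K \<mu> g \<sigma>" "complementarity K \<mu> g \<sigma>"
  shows "is_optimal_relax d K \<mu> k g"
  unfolding is_optimal_relax_def is_arg_min_def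
proof (intro conjI notI)
  have g: "g \<in> compact_forms (2 * d)" using assms(2) by (simp add: feasible_relax_iff)
  assume "\<exists>f. f \<in> feasible_relax d K \<mu> k \<and> objective f < objective g"
  then obtain f where f: "f \<in> feasible_relax d K \<mu> k" "objective f < objective g" by blast
  then have fc: "f \<in> compact_forms (2 * d)" by (simp add: feasible_relax_iff)
  have forms: "f \<in> forms (2 * d)" "g \<in> forms (2 * d)"
    using fc g by (simp_all add: compact_forms_def)
  have "integ (\<lambda>x. peval g x * peval \<sigma> x) - integ (\<lambda>x. peval f x * peval \<sigma> x)
      \<le> objective f - objective g"
    using objective_gradient_ineq[OF g fc] assms(1) forms
    by (simp add: moment_condition_forms[OF assms(4) g assms(1)])
  moreover have "integ (\<lambda>x. (1 - peval g x) * peval \<sigma> x) = 0"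
    using assms(5) by (simp add: complementarity_def integ_def)
  ultimately show False
    using feasible_relax_sos[OF f(1) assms(3)] f(2) by (simp add: integ_one_minus)
qed (rule assms(2))

lemma opt_val_relax_eq:
  assumes "is_optimal_relax d K \<mu> k g"
  shows "opt_val_relax d K \<mu> k = ereal (objective g)"
  using assms unfolding opt_val_relax_def is_optimal_relax_def is_arg_min_def
  by (intro INF_eqI) (auto simp: not_less)

text \<open>If no multiplier exists, the alternative provides a form \<open>H\<close> along which the objective
  decreases to first order, and \<open>g + t H\<close> remains feasible for small \<open>t\<close> because
  \<open>integ (H \<sigma>)\<close> is at most a multiple of the slack \<open>integ ((1 - g) \<sigma>)\<close>.\<close>

lemma kkt_necessary:
  assumes "d \<ge> 1" "is_optimal_relax d K \<mu> k g"
  obtains \<sigma> where "\<sigma> \<in> sos k" "moment_condition d K \<mu> g \<sigma>" "complementarity K \<mu> g \<sigma>"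
    "opt_val_relax d K \<mu> k = ereal (2 * real d / real CARD('n) * (LINT x:K|\<mu>. peval \<sigma> x))"
proof -
  have d: "2 * d > 0" using assms(1) by simp
  have feas: "g \<in> feasible_relax d K \<mu> k"
    and opt: "\<And>f. f \<in> feasible_relax d K \<mu> k \<Longrightarrow> objective g \<le> objective f"
    using assms(2) by (auto simp: is_optimal_relax_def is_arg_min_def not_less)
  have gc: "g \<in> compact_forms (2 * d)" using feas by (simp add: feasible_relax_iff)
  then have gf: "g \<in> forms (2 * d)" by (simp add: compact_forms_def)
  let ?D = "{\<alpha> :: 'n midx. mdeg \<alpha> = 2 * d}"
  \<comment> \<open>\<open>None\<close> carries the complementarity equation (2),
    \<open>Some \<alpha>\<close> the moment equation (1) for \<alpha>.\<close>
  define J where "J = insert None (Some ` ?D)"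
  define \<phi> where "\<phi> j = (case j of None \<Rightarrow> \<lambda>x. 1 - peval g x | Some \<alpha> \<Rightarrow> monomial \<alpha>)" for j
  \<comment> \<open>Weights for which the test functions add up to
    \<open>(1 - g) + g = 1\<close>.\<close>
  define w where "w j = (case j of None \<Rightarrow> 1 | Some \<alpha> \<Rightarrow> Poly_Mapping.lookup g \<alpha>)" for j
  define y where "y j = (case j of None \<Rightarrow> 0
    | Some \<alpha> \<Rightarrow> LINT x|lborel. monomial \<alpha> x * exp (- peval g x))" for j
  have finJ: "finite J" by (simp add: J_def finite_mdeg_eq)
  have sumJ: "(\<Sum>j\<in>J. F j) = F None + (\<Sum>\<alpha>\<in>?D. F (Some \<alpha>))" for F :: "_ \<Rightarrow> real"
    by (simp add: J_def sum.reindex finite_mdeg_eq)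
  have cont: "continuous_on UNIV (\<phi> j)" for j
    by (cases j) (auto simp: \<phi>_def intro!: continuous_intros)
  have one: "(\<Sum>j\<in>J. w j * \<phi> j x) = 1" for x
    by (simp add: sumJ w_def \<phi>_def peval_form[OF gf])
  from finJ cont one show ?thesis
  proof (rule sos_moment_alternative[where k = k and y = y])
    fix \<sigma> assume \<sigma>: "\<sigma> \<in> sos k" "\<And>j. j \<in> J \<Longrightarrow> integ (\<lambda>x. \<phi> j x * peval \<sigma> x) = y j"
    have mc: "moment_condition d K \<mu> g \<sigma>"
      unfolding moment_condition_def
    proof (intro allI impI)
      fix \<alpha> :: "'n midx" assume "mdeg \<alpha> = 2 * d"
      then show "(LINT x|lborel. monomial \<alpha> x * exp (- peval g x))
          = (LINT x:K|\<mu>. monomial \<alpha> x * peval \<sigma> x)"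
        using \<sigma>(2)[of "Some \<alpha>"] by (simp add: J_def \<phi>_def y_def integ_def)
    qed
    have comp: "integ (\<lambda>x. (1 - peval g x) * peval \<sigma> x) = 0"
      using \<sigma>(2)[of None] by (simp add: J_def \<phi>_def y_def)
    have "real CARD('n) / real (2 * d) * objective g = integ (peval \<sigma>)"
      using integral_form_exp_neg_self[OF gc d] moment_condition_forms[OF mc gc assms(1) gf] comp
      by (simp add: integ_one_minus)
    then have "objective g = 2 * real d / real CARD('n) * integ (peval \<sigma>)"
      using assms(1) by (simp add: field_simps)
    then show ?thesis
      using \<sigma>(1) mc comp opt_val_relax_eq[OF assms(2)]
      by (intro that[of \<sigma>]) (auto simp: complementarity_def integ_def)
  next
    fix h assume h: "(\<Sum>j\<in>J. h j * y j) > 0"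
      "\<And>\<sigma>. \<sigma> \<in> sos k \<Longrightarrow> (\<Sum>j\<in>J. h j * integ (\<lambda>x. \<phi> j x * peval \<sigma> x)) \<le> 0"
    define H where "H = form_of (2 * d) (\<lambda>\<alpha>. h (Some \<alpha>))"
    have Hf: "H \<in> forms (2 * d)" unfolding H_def by (rule form_of_in_forms)
    have int: "integrable lborel (\<lambda>x. monomial \<alpha> x * exp (- peval g x))" if "\<alpha> \<in> ?D" for \<alpha>
      using integrable_form_exp_neg[OF gc d, of "Poly_Mapping.single \<alpha> 1"] that
      by (simp add: peval_single forms_def)
    have "(LINT x|lborel. peval H x * exp (- peval g x))
        = (LINT x|lborel. (\<Sum>\<alpha>\<in>?D. h (Some \<alpha>) * (monomial \<alpha> x * exp (- peval g x))))"
      by (simp add: H_def peval_poly_of sum_distrib_right mult.assoc)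
    also have "\<dots> = (\<Sum>\<alpha>\<in>?D. h (Some \<alpha>) * y (Some \<alpha>))"
      using int by (simp add: y_def)
    finally have pos: "(LINT x|lborel. peval H x * exp (- peval g x)) > 0"
      using h(1) by (simp add: sumJ y_def)
    have slack: "integ (\<lambda>x. peval H x * peval \<sigma> x)
        \<le> - h None * integ (\<lambda>x. (1 - peval g x) * peval \<sigma> x)" if "\<sigma> \<in> sos k" for \<sigma>
    proof -
      have "integ (\<lambda>x. peval H x * peval \<sigma> x)
          = integ (\<lambda>x. \<Sum>\<alpha>\<in>?D. h (Some \<alpha>) * (monomial \<alpha> x * peval \<sigma> x))"
        by (simp add: H_def peval_poly_of sum_distrib_right mult.assoc)
      also have "\<dots> = (\<Sum>\<alpha>\<in>?D. integ (\<lambda>x. h (Some \<alpha>) * (monomial \<alpha> x * peval \<sigma> x)))"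
        by (intro integ_sum continuous_intros)
      finally show ?thesis using h(2)[OF that] by (simp add: sumJ \<phi>_def integ_cmult)
    qed
    \<comment> \<open>Chosen so that \<open>s * (- h None) \<le> 1\<close>; the maximum keeps
      \<open>s\<close> positive whatever the sign of \<open>h None\<close>.\<close>
    define s where "s = 1 / max 1 (- h None)"
    have s: "s > 0" by (simp add: s_def)
    obtain t f where t: "0 < t" "t \<le> s" and f: "f \<in> compact_forms (2 * d)"
      "\<And>x. peval f x = peval g x + t * peval H x" "objective f < objective g"
      using objective_descent[OF gc d Hf s pos] by blast
    have "f \<in> feasible_relax d K \<mu> k"
      unfolding feasible_relax_iff
    proof (intro conjI ballI f(1))
      fix q :: "'n rpoly" assume "q \<in> polys_upto k"
      then have q2: "q ^ 2 \<in> sos k" unfolding sos_def by (intro CollectI exI[of _ "[q]"]) auto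
      define c where "c = integ (\<lambda>x. (1 - peval g x) * peval (q ^ 2) x)"
      define b where "b = integ (\<lambda>x. peval H x * peval (q ^ 2) x)"
      have c: "c \<ge> 0" unfolding c_def by (rule feasible_relax_sos[OF feas q2])
      have "b \<le> - h None * c" unfolding b_def c_def by (rule slack[OF q2])
      also have "\<dots> \<le> max 1 (- h None) * c" using c by (intro mult_right_mono) auto
      finally have "s * b \<le> c" by (simp add: s_def field_simps)
      moreover have "t * b \<le> max 0 (s * b)"
        using t mult_right_mono[of t s b] mult_nonneg_nonpos[of t b] by (cases "b \<ge> 0") auto
      ultimately have "t * b \<le> c" using c by linarith
      moreover have "integ (\<lambda>x. (1 - peval f x) * (peval q x)\<^sup>2) = c - t * b"
      proof -
        have "integ (\<lambda>x. (1 - peval f x) * (peval q x)\<^sup>2)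
            = integ (\<lambda>x. (1 - peval g x) * peval (q ^ 2) x - t * (peval H x * peval (q ^ 2) x))"
          by (simp add: f(2) peval_power algebra_simps)
        also have "\<dots> = c - t * b"
          unfolding b_def c_def integ_cmult[symmetric] by (intro integ_diff continuous_intros)
        finally show ?thesis .
      qed
      ultimately show "0 \<le> integ (\<lambda>x. (1 - peval f x) * (peval q x)\<^sup>2)" by simp
    qed
    from opt[OF this] f(3) show ?thesis by simp
  qed
qed

text \<open>It suffices to test against the square of the negative part of \<open>f\<close>, which is a uniform limit
  of polynomials on \<open>K\<close>.\<close>

lemma nonneg_on_K_if_integ_squares_nonneg:
  assumes cont: "continuous_on UNIV f"
    and nonneg: "\<And>q. 0 \<le> integ (\<lambda>x. f x * (peval q x)\<^sup>2)" and "a \<in> K"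
  shows "0 \<le> f a"
proof (rule ccontr)
  assume neg: "\<not> 0 \<le> f a"
  define \<psi> where "\<psi> x = max 0 (- f x)" for x
  have cont\<psi>: "continuous_on UNIV \<psi>" unfolding \<psi>_def by (intro continuous_intros cont)
  \<comment> \<open>The integral of \<open>\<psi> ^ 3\<close>, positive because
    \<open>\<psi> a > 0\<close> at a point of the support.\<close>
  define \<delta> where "\<delta> = integ (\<lambda>x. - f x * (\<psi> x)\<^sup>2)"
  have \<delta>: "\<delta> > 0"
    unfolding \<delta>_def using assms(3) neg
    by (intro integ_pos[of _ a] continuous_intros cont cont\<psi>)
       (auto simp: \<psi>_def max_def mult_nonpos_nonneg mult_neg_pos not_le)
  have "compact (f ` K)"
    using compact_K cont by (intro compact_continuous_image) (auto intro: continuous_on_subset)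
  then obtain B where B: "B > 0" "\<And>x. x \<in> K \<Longrightarrow> \<bar>f x\<bar> \<le> B"
    using compact_imp_bounded bounded_pos by (metis imageI real_norm_def)
  have one: "integ (\<lambda>_. 1) \<ge> 0" by (rule integ_nonneg) simp
  \<comment> \<open>On \<open>K\<close>, replacing \<psi> by a polynomial within
    \<open>e \<le> 1\<close> changes \<open>f * \<psi>\<^sup>2\<close> by at most
    \<open>B * (2 * B + 1) * e\<close>; integrated, this is \<open>c * e\<close>, and
    \<open>e\<close> is chosen to make it less than \<delta>.\<close>
  define c where "c = B * (2 * B + 1) * integ (\<lambda>_. 1)"
  have c: "c \<ge> 0" using B(1) one by (simp add: c_def)
  define e where "e = min 1 (\<delta> / (c + 1))"
  have e: "0 < e" "e \<le> 1" using c \<delta> by (auto simp: e_def)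
  obtain p where p: "real_polynomial_function p" "\<And>x. x \<in> K \<Longrightarrow> \<bar>\<psi> x - p x\<bar> < e"
    using Stone_Weierstrass_real_polynomial_function[OF compact_K _ e(1)]
      continuous_on_subset[OF cont\<psi>] by blast
  obtain q where q: "\<And>x. peval q x = p x" using peval_real_polynomial_function[OF p(1)] by blast
  let ?C = "B * (2 * B + 1) * e"
  have "0 \<le> integ (\<lambda>x. - f x * (peval q x)\<^sup>2 - - f x * (\<psi> x)\<^sup>2 + ?C * 1)"
  proof (rule integ_nonneg)
    fix x assume x: "x \<in> K"
    have "0 \<le> \<psi> x" "\<psi> x \<le> B" using B(1) B(2)[OF x] by (auto simp: \<psi>_def)
    moreover have pq: "\<bar>\<psi> x - peval q x\<bar> \<le> e" using p(2)[OF x] q by simp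
    ultimately have "\<bar>\<psi> x + peval q x\<bar> \<le> 2 * B + 1" using e(2) by linarith
    with pq have "\<bar>\<psi> x - peval q x\<bar> * \<bar>\<psi> x + peval q x\<bar> \<le> e * (2 * B + 1)"
      using e(1) by (intro mult_mono) auto
    then have "\<bar>(\<psi> x)\<^sup>2 - (peval q x)\<^sup>2\<bar> \<le> e * (2 * B + 1)"
      by (simp add: abs_mult[symmetric] power2_eq_square algebra_simps)
    then have "\<bar>f x\<bar> * \<bar>(\<psi> x)\<^sup>2 - (peval q x)\<^sup>2\<bar> \<le> B * (e * (2 * B + 1))"
      using B(1) B(2)[OF x] by (intro mult_mono) auto
    then have "\<bar>f x * ((\<psi> x)\<^sup>2 - (peval q x)\<^sup>2)\<bar> \<le> ?C" by (simp add: abs_mult mult_ac)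
    then show "0 \<le> - f x * (peval q x)\<^sup>2 - - f x * (\<psi> x)\<^sup>2 + ?C * 1"
      by (simp add: abs_le_iff algebra_simps)
  qed
  also have "\<dots> = integ (\<lambda>x. - f x * (peval q x)\<^sup>2) - \<delta> + ?C * integ (\<lambda>_. 1)"
    unfolding \<delta>_def integ_cmult[symmetric]
    by (subst integ_diff[symmetric] integ_add[symmetric]; (intro continuous_intros cont cont\<psi>)?)+ simp
  also have "integ (\<lambda>x. - f x * (peval q x)\<^sup>2) = - integ (\<lambda>x. f x * (peval q x)\<^sup>2)"
    using integ_cmult[of "- 1" "\<lambda>x. f x * (peval q x)\<^sup>2"] by simp
  also have "?C * integ (\<lambda>_. 1) = c * e" by (simp add: c_def)
  also have "c * e < \<delta>"
  proof -
    have "c * e \<le> c * (\<delta> / (c + 1))" using c by (intro mult_left_mono) (auto simp: e_def)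
    also have "\<dots> < \<delta>" using c \<delta> by (simp add: field_simps)
    finally show ?thesis .
  qed
  finally show False using nonneg[of q] by linarith
qed

text \<open>Since \<open>(1 - t) * g\<close> is nonnegative, the combination with \<open>f\<close>
  is coercive with \<open>t\<close> times the constant of \<open>f\<close>, hence feasible for
  \<open>0 < t\<close>. Convexity bounds its objective, and \<open>t\<close> tends to 0 along
  \<open>1 / (n + 1)\<close>.\<close>

lemma opt_val_le_objective_of_limit:
  assumes "d \<ge> 1" "f \<in> feasible d K" "g \<in> forms (2 * d)" "\<And>x. 0 \<le> peval g x"
    and "\<And>x. x \<in> K \<Longrightarrow> peval g x \<le> 1" "integrable lborel (\<lambda>x. exp (- peval g x))"
  shows "opt_val d K \<le> ereal (objective g)"
proof -
  have d: "2 * d > 0" using assms(1) by simp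
  have fc: "f \<in> compact_forms (2 * d)" and fK: "\<And>x. x \<in> K \<Longrightarrow> peval f x \<le> 1"
    using assms(2) by (auto simp: feasible_def nonneg_polys_def peval_diff)
  then have ff: "f \<in> forms (2 * d)" by (simp add: compact_forms_def)
  obtain c where c: "c > 0" "\<And>x. c * norm x ^ (2 * d) \<le> peval f x"
    using compact_form_coercive[OF fc d] by blast
  have le: "opt_val d K \<le> ereal ((1 - t) * objective g + t * objective f)" if t: "0 < t" "t \<le> 1" for t
  proof -
    define h where "h = form_of (2 * d)
      (\<lambda>\<alpha>. (1 - t) * Poly_Mapping.lookup g \<alpha> + t * Poly_Mapping.lookup f \<alpha>)"
    have hf: "h \<in> forms (2 * d)" unfolding h_def by (rule form_of_in_forms)
    have h: "peval h x = (1 - t) * peval g x + t * peval f x" for x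
      unfolding h_def by (rule peval_form_combination[OF assms(3) ff])
    have "h \<in> compact_forms (2 * d)"
    proof (rule coercive_form_compact[OF hf d])
      show "t * c > 0" using t c by simp
      fix x
      have "t * (c * norm x ^ (2 * d)) \<le> t * peval f x"
        using c(2)[of x] t by (intro mult_left_mono) auto
      moreover have "0 \<le> (1 - t) * peval g x" using assms(4) t by simp
      ultimately show "t * c * norm x ^ (2 * d) \<le> peval h x"
        unfolding h mult.assoc by linarith
    qed
    moreover have "peval h x \<le> 1" if "x \<in> K" for x
      unfolding h using t by (intro convex_bound_le assms(5) fK that) auto
    ultimately have "h \<in> feasible d K"
      using one_minus_form_in_polys_upto[OF hf]
      by (auto simp: feasible_def nonneg_polys_def peval_diff)
    then have "opt_val d K \<le> ereal (objective h)" unfolding opt_val_def by (rule INF_lower)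
    also have "\<dots> \<le> ereal ((1 - t) * objective g + t * objective f)"
      using objective_convex_combination[OF _ _ assms(6) integrable_exp_neg_form[OF fc d] h] t
      by simp
    finally show ?thesis .
  qed
  have "(\<lambda>n. (1 - inverse (real (Suc n))) * objective g + inverse (real (Suc n)) * objective f)
      \<longlonglongrightarrow> (1 - 0) * objective g + 0 * objective f"
    by (intro tendsto_intros LIMSEQ_inverse_real_of_nat)
  then have "(\<lambda>n. ereal ((1 - inverse (real (Suc n))) * objective g + inverse (real (Suc n)) * objective f))
      \<longlonglongrightarrow> ereal (objective g)" by simp
  moreover have "opt_val d K
      \<le> ereal ((1 - inverse (real (Suc n))) * objective g + inverse (real (Suc n)) * objective f)" for n
    by (rule le) (simp_all add: inverse_le_1_iff)
  ultimately show ?thesis by (intro LIMSEQ_le_const) blast+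
qed

text \<open>Dividing \<open>g\<close> by a bound for it on \<open>K\<close> makes it feasible. The
  result bounds the objectives of the relaxations from above and is the second form in the convex
  combinations.\<close>

lemma feasible_nonempty:
  fixes g :: "'n rpoly"
  assumes "d \<ge> 1" "g \<in> compact_forms (2 * d)"
  obtains f where "f \<in> feasible d K"
proof -
  have "compact (peval g ` K)"
    using compact_K by (intro compact_continuous_image continuous_on_peval)
  then obtain B where B: "B > 0" "\<And>x. x \<in> K \<Longrightarrow> \<bar>peval g x\<bar> \<le> B"
    using compact_imp_bounded bounded_pos by (metis imageI real_norm_def)
  obtain f where f: "f \<in> compact_forms (2 * d)" "\<And>x. peval f x = 1 / B * peval g x"
    using compact_form_scale[of g "2 * d" "1 / B"] assms B(1) by auto
  have "peval f x \<le> 1" if "x \<in> K" for x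
    using B(1) B(2)[OF that] by (simp add: f(2) field_simps)
  moreover have "1 - f \<in> polys_upto (2 * d)"
    using f(1) by (intro one_minus_form_in_polys_upto) (simp add: compact_forms_def)
  ultimately show ?thesis
    using f(1) by (intro that[of f]) (auto simp: feasible_def nonneg_polys_def peval_diff)
qed

lemma tendsto_integ_forms:
  assumes "\<And>j. g j \<in> forms m" "f \<in> forms m"
    and "\<And>\<alpha>. (\<lambda>j. Poly_Mapping.lookup (g j) \<alpha>) \<longlonglongrightarrow> Poly_Mapping.lookup f \<alpha>"
  shows "(\<lambda>j. integ (\<lambda>x. peval (g j) x * peval \<sigma> x)) \<longlonglongrightarrow> integ (\<lambda>x. peval f x * peval \<sigma> x)"
proof -
  have eq: "integ (\<lambda>x. peval h x * peval \<sigma> x)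
      = (\<Sum>\<alpha> | mdeg \<alpha> = m. Poly_Mapping.lookup h \<alpha> * integ (\<lambda>x. monomial \<alpha> x * peval \<sigma> x))"
    if "h \<in> forms m" for h
  proof -
    have "integ (\<lambda>x. peval h x * peval \<sigma> x) = integ (\<lambda>x. \<Sum>\<alpha> | mdeg \<alpha> = m.
        Poly_Mapping.lookup h \<alpha> * (monomial \<alpha> x * peval \<sigma> x))"
      by (simp add: peval_form[OF that] sum_distrib_right mult.assoc)
    also have "\<dots> = (\<Sum>\<alpha> | mdeg \<alpha> = m.
        integ (\<lambda>x. Poly_Mapping.lookup h \<alpha> * (monomial \<alpha> x * peval \<sigma> x)))"
      by (intro integ_sum continuous_intros)
    finally show ?thesis by (simp only: integ_cmult)
  qed
  show ?thesis
    unfolding eq[OF assms(1)] eq[OF assms(2)] by (intro tendsto_intros assms(3))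
qed

lemma relaxation_convergence:
  assumes "d \<ge> 1" and opt: "\<And>k. is_optimal_relax d K \<mu> k (g k)"
    and bound: "\<And>k \<alpha>. mdeg \<alpha> = 2 * d \<Longrightarrow> \<bar>Poly_Mapping.lookup (g k) \<alpha>\<bar> \<le> M"
  shows "opt_val_relax d K \<mu> \<longlonglongrightarrow> opt_val d K"
    and "\<exists>f\<in>forms (2 * d). 1 - f \<in> nonneg_polys (2 * d) K \<and>
      integrable lborel (\<lambda>x. exp (- peval f x)) \<and> ereal (objective f) = opt_val d K \<and>
      (bounded (\<Union>k. sublevel (g k)) \<longrightarrow> is_optimal d K f)"
proof -
  have d: "2 * d > 0" using assms(1) by simp
  have feas: "g k \<in> feasible_relax d K \<mu> k" for k
    using opt[of k] by (simp add: is_optimal_relax_def is_arg_min_def)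
  have best: "objective (g k) \<le> objective h" if "h \<in> feasible_relax d K \<mu> k" for h k
    using opt[of k] that by (auto simp: is_optimal_relax_def is_arg_min_def not_less)
  have gc: "g k \<in> compact_forms (2 * d)" for k using feas[of k] by (simp add: feasible_relax_iff)
  then have gf: "g k \<in> forms (2 * d)" for k by (simp add: compact_forms_def)
  obtain f0 where f0: "f0 \<in> feasible d K" using feasible_nonempty[OF assms(1) gc] by blast
  have le_opt: "ereal (objective (g k)) \<le> opt_val d K" for k
    unfolding opt_val_def using best[OF subsetD[OF feasible_subset_relax]] by (intro INF_greatest) simp
  have inc: "incseq (\<lambda>k. objective (g k))"
    using best feas feasible_relax_antimono by (intro monoI) blast
  moreover have "objective (g k) \<le> objective f0" for k
    by (rule best[OF subsetD[OF feasible_subset_relax f0]])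
  ultimately obtain B where B: "(\<lambda>k. objective (g k)) \<longlonglongrightarrow> B" "\<And>k. objective (g k) \<le> B"
    using incseq_convergent by metis
  have relax_lim: "opt_val_relax d K \<mu> \<longlonglongrightarrow> ereal B"
    using B(1) unfolding opt_val_relax_eq[OF opt, abs_def] by simp
  have B_le: "ereal B \<le> opt_val d K"
    using B(1) le_opt by (intro LIMSEQ_le_const2[of "\<lambda>k. ereal (objective (g k))"]) auto
  obtain f r where f: "f \<in> forms (2 * d)" and r: "strict_mono (r :: nat \<Rightarrow> nat)"
    and lim: "\<And>\<alpha>. (\<lambda>j. Poly_Mapping.lookup (g (r j)) \<alpha>) \<longlonglongrightarrow> Poly_Mapping.lookup f \<alpha>"
    using bounded_forms_convergent_subsequence[where g = g, OF gf bound] by blast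
  have plim: "(\<lambda>j. peval (g (r j)) x) \<longlonglongrightarrow> peval f x" for x
    by (rule tendsto_peval_forms[OF gf f lim])
  have nonneg: "0 \<le> peval f x" for x
    using compact_form_nonneg[OF gc d] by (intro LIMSEQ_le_const[OF plim]) auto
  have fK: "0 \<le> 1 - peval f x" if "x \<in> K" for x
  proof (rule nonneg_on_K_if_integ_squares_nonneg[OF _ _ that])
    show "continuous_on UNIV (\<lambda>x. 1 - peval f x)" by (intro continuous_intros)
    fix q :: "'n rpoly"
    obtain k where q: "q \<in> polys_upto k"
    proof
      show "q \<in> polys_upto (\<Sum>\<alpha>\<in>Poly_Mapping.keys q. mdeg \<alpha>)"
        unfolding polys_upto_def by (auto intro: member_le_sum)
    qed
    have split: "integ (\<lambda>x. (1 - peval h x) * (peval q x)\<^sup>2)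
        = integ (peval (q\<^sup>2)) - integ (\<lambda>x. peval h x * peval (q\<^sup>2) x)" for h
      using integ_one_minus[of h "q\<^sup>2"] by (simp add: peval_power)
    have "(\<lambda>j. integ (\<lambda>x. (1 - peval (g (r j)) x) * (peval q x)\<^sup>2))
        \<longlonglongrightarrow> integ (\<lambda>x. (1 - peval f x) * (peval q x)\<^sup>2)"
      unfolding split by (intro tendsto_intros tendsto_integ_forms[OF gf f lim])
    \<comment> \<open>For \<open>q\<close> of degree at most \<open>k\<close>, each
      \<open>g (r j)\<close> with \<open>j \<ge> k\<close> passes the test, because
      \<open>r j \<ge> j\<close> and the feasible sets shrink.\<close>
    moreover have "0 \<le> integ (\<lambda>x. (1 - peval (g (r j)) x) * (peval q x)\<^sup>2)" if "j \<ge> k" for j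
    proof -
      have "g (r j) \<in> feasible_relax d K \<mu> k"
        using feas feasible_relax_antimono that seq_suble[OF r, of j] order_trans by blast
      then show ?thesis using q by (simp add: feasible_relax_iff)
    qed
    ultimately show "0 \<le> integ (\<lambda>x. (1 - peval f x) * (peval q x)\<^sup>2)"
      by (intro LIMSEQ_le_const) auto
  qed
  have int_f: "integrable lborel (\<lambda>x. exp (- peval f x))" and obj_f: "objective f \<le> B"
    using fatou_objective[OF plim integrable_exp_neg_form[OF gc d] B(2)] by auto
  have opt_le: "opt_val d K \<le> ereal (objective f)"
    using opt_val_le_objective_of_limit[OF assms(1) f0 f nonneg _ int_f] fK by simp
  then have eq: "opt_val d K = ereal B" "ereal (objective f) = opt_val d K"
    using B_le obj_f by (auto intro!: antisym order_trans[OF opt_le] order_trans[OF _ B_le])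
  show "opt_val_relax d K \<mu> \<longlonglongrightarrow> opt_val d K" using relax_lim eq(1) by simp
  have nnp: "1 - f \<in> nonneg_polys (2 * d) K"
    using one_minus_form_in_polys_upto[OF f] fK by (simp add: nonneg_polys_def peval_diff)
  have "is_optimal d K f" if "bounded (\<Union>k. sublevel (g k))"
  proof -
    have "bounded (\<Union>j. sublevel (g (r j)))" by (rule bounded_subset[OF that]) blast
    then have "f \<in> compact_forms (2 * d)"
      by (rule form_compact_if_sublevels_bounded[OF f d nonneg plim])
    then have "f \<in> feasible d K" using nnp by (simp add: feasible_def)
    moreover have "ereal (objective f) \<le> ereal (objective h)" if "h \<in> feasible d K" for h
      unfolding eq(2) opt_val_def using that by (rule INF_lower)
    ultimately show ?thesis by (auto simp: is_optimal_def is_arg_min_def not_less)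
  qed
  with f nnp int_f eq(2) show "\<exists>f\<in>forms (2 * d). 1 - f \<in> nonneg_polys (2 * d) K \<and>
      integrable lborel (\<lambda>x. exp (- peval f x)) \<and> ereal (objective f) = opt_val d K \<and>
      (bounded (\<Union>k. sublevel (g k)) \<longrightarrow> is_optimal d K f)" by blast
qed

end

text \<open>The converse is stated for feasible \<open>g\<close>, since (1) and (2) do not imply
  feasibility: for n = d = k = 1 and Lebesgue measure on [-1, 1], the form 3 x^2 satisfies both with
  a suitable positive constant \<sigma>, but the localizing matrix of 1 - 3 x^2 has the diagonal
  entry 2/3 - 6/5 < 0.\<close>

theorem theorem3p4:
  fixes K :: "(real ^ 'n::finite) set" and \<mu> :: "(real ^ 'n) measure" and d :: nat
  assumes "d \<ge> 1"
    and "compact K" and "interior K \<noteq> {}"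
    and "sets \<mu> = sets borel" and "finite_measure \<mu>" and "msupport \<mu> = K"
  shows "mono (opt_val_relax d K \<mu>) \<and> (\<forall>k. opt_val_relax d K \<mu> k \<le> opt_val d K)
    \<and> (\<forall>k g. is_optimal_relax d K \<mu> k g \<longrightarrow>
         (\<exists>\<sigma>\<in>sos k. moment_condition d K \<mu> g \<sigma> \<and> complementarity K \<mu> g \<sigma> \<and>
            opt_val_relax d K \<mu> k =
              ereal (2 * real d / real CARD('n) * (LINT x:K|\<mu>. peval \<sigma> x))))
    \<and> (\<forall>k. \<forall>g\<in>feasible_relax d K \<mu> k. \<forall>\<sigma>\<in>sos k.
         moment_condition d K \<mu> g \<sigma> \<and> complementarity K \<mu> g \<sigma> \<longrightarrow>
         is_optimal_relax d K \<mu> k g)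
    \<and> (\<forall>(g :: nat \<Rightarrow> 'n rpoly) (M :: real).
         (\<forall>k. is_optimal_relax d K \<mu> k (g k)) \<and> M > 0 \<and>
         (SUP k. SUP \<alpha>\<in>{\<alpha>. mdeg \<alpha> = 2 * d}. ereal \<bar>Poly_Mapping.lookup (g k) \<alpha>\<bar>) < ereal M \<longrightarrow>
         opt_val_relax d K \<mu> \<longlonglongrightarrow> opt_val d K \<and>
         (\<exists>gs\<in>forms (2 * d). 1 - gs \<in> nonneg_polys (2 * d) K \<and>
            integrable lborel (\<lambda>x. exp (- peval gs x)) \<and> ereal (objective gs) = opt_val d K \<and>
            (bounded (\<Union>k. sublevel (g k)) \<longrightarrow> is_optimal d K gs)))"
proof -
  interpret moment_setting K \<mu> by (rule moment_setting.intro) fact+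
  have "mono (opt_val_relax d K \<mu>)"
    unfolding opt_val_relax_def by (intro monoI INF_superset_mono feasible_relax_antimono) auto
  moreover have "opt_val_relax d K \<mu> k \<le> opt_val d K" for k
    unfolding opt_val_relax_def opt_val_def by (intro INF_superset_mono feasible_subset_relax) auto
  moreover have "\<exists>\<sigma>\<in>sos k. moment_condition d K \<mu> g \<sigma> \<and> complementarity K \<mu> g \<sigma> \<and>
      opt_val_relax d K \<mu> k = ereal (2 * real d / real CARD('n) * (LINT x:K|\<mu>. peval \<sigma> x))"
    if "is_optimal_relax d K \<mu> k g" for k g
    using kkt_necessary[OF assms(1) that] by metis
  moreover have "is_optimal_relax d K \<mu> k g"
    if "g \<in> feasible_relax d K \<mu> k" "\<sigma> \<in> sos k"
      "moment_condition d K \<mu> g \<sigma> \<and> complementarity K \<mu> g \<sigma>" for k g \<sigma>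
    using kkt_sufficient[OF assms(1)] that by blast
  moreover have "opt_val_relax d K \<mu> \<longlonglongrightarrow> opt_val d K \<and>
      (\<exists>gs\<in>forms (2 * d). 1 - gs \<in> nonneg_polys (2 * d) K \<and>
         integrable lborel (\<lambda>x. exp (- peval gs x)) \<and> ereal (objective gs) = opt_val d K \<and>
         (bounded (\<Union>k. sublevel (g k)) \<longrightarrow> is_optimal d K gs))"
    if *: "(\<forall>k. is_optimal_relax d K \<mu> k (g k)) \<and> M > 0 \<and>
      (SUP k. SUP \<alpha>\<in>{\<alpha>. mdeg \<alpha> = 2 * d}. ereal \<bar>Poly_Mapping.lookup (g k) \<alpha>\<bar>) < ereal M"
    for g :: "nat \<Rightarrow> 'n rpoly" and M :: real
  proof -
    have "\<bar>Poly_Mapping.lookup (g k) \<alpha>\<bar> \<le> M" if \<alpha>: "mdeg \<alpha> = 2 * d" for k \<alpha>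
    proof -
      have "ereal \<bar>Poly_Mapping.lookup (g k) \<alpha>\<bar>
          \<le> (SUP \<alpha>\<in>{\<alpha>. mdeg \<alpha> = 2 * d}. ereal \<bar>Poly_Mapping.lookup (g k) \<alpha>\<bar>)"
        using \<alpha> by (intro SUP_upper) simp
      also have "\<dots> \<le> (SUP k. SUP \<alpha>\<in>{\<alpha>. mdeg \<alpha> = 2 * d}. ereal \<bar>Poly_Mapping.lookup (g k) \<alpha>\<bar>)"
        by (intro SUP_upper) simp
      also have "\<dots> < ereal M" using * by blast
      finally show ?thesis by simp
    qed
    then show ?thesis using relaxation_convergence[OF assms(1), of g M] * by blast
  qed
  ultimately show ?thesis by blast
qed

end
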